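(* Let $\tau > \omega$ be a cardinal. Any homeomorphism between closed $C$-embedded and Lindelöf subsets of $R^{\tau}$ can be extended to an autohomeomorphism of $R^{\tau}$.
   Context: $R$ is the real line and $R^{\tau}$ is the product of $\tau$ copies of $R$ with the product topology. A subset $Z$ of a space $X$ is $C$-embedded if every continuous real-valued function on $Z$ extends to a continuous real-valued function on $X$. *)

theory Defs
  imports "HOL-Analysis.Analysis"
begin

definition C_embedded_in :: "'a topology \<Rightarrow> 'a set \<Rightarrow> bool"
  where "C_embedded_in X Z \<longleftrightarrow>
    Z \<subseteq> topspace X \<and>
    (\<forall>f. continuous_map (subtopology X Z) euclideanreal f \<longrightarrow>
      (\<exists>g. continuous_map X euclideanreal g \<and> (\<forall>z\<in>Z. g z = f z)))"

end

theory Submission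
  imports Defs
begin

text \<open>
  The space of extensional functions on I is a subspace of the full product 'i \<Rightarrow> real, and all
  constructions take place in that product; they leave the coordinates outside I alone.

  The theorem rests on Klee's trick. Split I into two parts J and K and suppose that A vanishes on
  K while B vanishes on J. A homeomorphism f : A \<rightarrow> B then has an extension: its coordinates
  extend continuously because A is C-embedded, a shear (x, y) \<mapsto> (x, y + f x) moves A onto the graph of
  f, and a second shear, built in the same way from the inverse of f, moves the graph onto B. Hence it
  suffices to find a single homeomorphism of the whole product which makes the coordinates
  in some K \<subseteq> I vanish on X = A \<union> B, where K and I - K have the same cardinality; a permutation of
  coordinates then brings the images of A and B into complementary position
  (\<open>flattening_homeo\<close> and \<open>extend_between_flat_sets\<close>).

  To make coordinates vanish, let P \<subseteq> I be uncountable. A Lindelof set X cannot project onto the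
  power indexed by P: on integer points the sets x i = x j form an open cover without countable
  subcover. So there is a point c which every x \<in> X misses in some coordinate from P, and countably many
  coordinates are enough to see this. By C-embeddedness X is completely separated from
  the zero set of points that agree with c in these coordinates. A continuous function on a
  power of the line depends on countably many coordinates, and so the separating function can be turned into
  a gauge r with r \<ge> 1 on X which is homogeneous of degree one under dilation, with centre c,
  of a countable set L \<subseteq> P of coordinates (\<open>gauge_exists\<close>).

  Given such a gauge, choose one more coordinate v. The quantity ln r + \<bar>v\<bar> does not change when v is
  moved and the coordinates in L are dilated to compensate. With m = max 1 (ln r + \<bar>v\<bar>) fixed, the set X
  satisfies \<bar>v\<bar> \<le> m, so v / m is bounded on X although v itself need not be. Three shears therefore
  exchange a coordinate u with \<epsilon> v / m up to sign, and this makes \<bar>u\<bar> \<le> \<epsilon> on X; the old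
  value of u survives in v (locale \<open>shear\<close>). If \<bar>u\<bar> \<le> 2 \<epsilon> on X beforehand, as is the case after the first step, the shears
  can be cut off so that u moves by at most 3 \<epsilon> everywhere; and the inverse is nonexpanding in u. With fresh v and L
  in each step and \<epsilon> = 1, 1/2, 1/4, ... the infinite composition therefore converges, together with its inverse,
  and u = 0 on X in the limit (locale \<open>carry\<close>, \<open>flattening_block\<close>).

  Such a block moves only countably many coordinates and looks only at countably many. Transfinite
  recursion along the cardinal order of I provides one block for each element of I, each of them moving
  only coordinates at which no earlier block looks. The blocks form a triangular system, so they can be
  applied simultaneously (\<open>triangular_homeo\<close>).
\<close>

section \<open>Continuous functions depend on countably many coordinates\<close>

definition depends_on :: "(('i \<Rightarrow> real) \<Rightarrow> 'b) \<Rightarrow> 'i set \<Rightarrow> bool"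
  where "depends_on f N \<longleftrightarrow> (\<forall>x y. (\<forall>i\<in>N. x i = y i) \<longrightarrow> f x = f y)"

lemma depends_onD: "depends_on f N \<Longrightarrow> (\<And>i. i \<in> N \<Longrightarrow> x i = y i) \<Longrightarrow> f x = f y"
  unfolding depends_on_def by blast

lemma depends_on_mono: "depends_on f M \<Longrightarrow> M \<subseteq> N \<Longrightarrow> depends_on f N"
  unfolding depends_on_def by blast

lemma depends_on_UNIV: "depends_on f UNIV"
proof -
  have "f x = f y" if "\<forall>i\<in>UNIV. x i = y i" for x y
  proof -
    have "x = y" using that by (simp add: fun_eq_iff)
    then show ?thesis by (rule arg_cong)
  qed
  then show ?thesis unfolding depends_on_def by blast
qed

lemma continuous_finitely_many_coordinates:
  fixes f :: "('i \<Rightarrow> real) \<Rightarrow> real"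
  assumes f: "continuous_on UNIV f" and e: "0 < e"
  obtains F d where "finite F" "0 < d" "\<And>y. (\<And>i. i \<in> F \<Longrightarrow> \<bar>y i - x i\<bar> < d) \<Longrightarrow> \<bar>f y - f x\<bar> < e"
proof -
  have "open (f -` {f x - e <..< f x + e})"
    using f by (simp add: continuous_on_open_vimage)
  then have op: "openin (product_topology (\<lambda>i. euclidean) UNIV) (f -` {f x - e <..< f x + e})"
    by (simp add: open_fun_def)
  have mem: "x \<in> f -` {f x - e <..< f x + e}" using e by simp
  obtain U where U: "x \<in> Pi\<^sub>E UNIV U" "\<And>i. openin euclidean (U i)"
      "finite {i. U i \<noteq> topspace (euclidean :: real topology)}"
      "Pi\<^sub>E UNIV U \<subseteq> f -` {f x - e <..< f x + e}"
    using product_topology_open_contains_basis[OF op mem] by blast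
  define F where "F = {i. U i \<noteq> (UNIV :: real set)}"
  have finF: "finite F" using U(3) by (simp add: F_def)
  have "\<exists>d>0. \<forall>t. \<bar>t - x i\<bar> < d \<longrightarrow> t \<in> U i" for i
  proof -
    have "open (U i)" "x i \<in> U i" using U(1,2) by (auto simp: PiE_def)
    then show ?thesis by (metis open_dist dist_real_def)
  qed
  then obtain d where d: "\<And>i. 0 < d i" "\<And>i t. \<bar>t - x i\<bar> < d i \<Longrightarrow> t \<in> U i" by metis
  define m where "m = Min (insert 1 (d ` F))"
  have m: "0 < m" "\<And>i. i \<in> F \<Longrightarrow> m \<le> d i"
    using finF d(1) by (auto simp: m_def)
  show thesis
  proof (rule that[OF finF m(1)])
    fix y assume y: "\<And>i. i \<in> F \<Longrightarrow> \<bar>y i - x i\<bar> < m"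
    have "y i \<in> U i" for i
    proof (cases "i \<in> F")
      case True then show ?thesis using y[OF True] m(2)[OF True] d(2) by force
    next
      case False then show ?thesis by (simp add: F_def)
    qed
    then have "y \<in> Pi\<^sub>E UNIV U" by (auto simp: PiE_def)
    then have "f y \<in> {f x - e <..< f x + e}" using U(4) by auto
    then show "\<bar>f y - f x\<bar> < e" by auto
  qed
qed

text \<open>
  One point z is handled by intersecting the finitely many conditions for the precisions 1/n. The exceptional set
  of coordinates still varies with z.
\<close>
lemma continuous_countable_neighbourhood:
  fixes f :: "('i \<Rightarrow> real) \<Rightarrow> real"
  assumes f: "continuous_on UNIV f"
  shows "\<exists>S. countable S \<and> (\<forall>w. (\<forall>i\<in>S. w i = z i) \<longrightarrow> f w = f z)"
proof -
  have "\<exists>F. finite F \<and> (\<forall>w. (\<forall>i\<in>F. w i = z i) \<longrightarrow> \<bar>f w - f z\<bar> < inverse (real (Suc n)))" for n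
  proof -
    obtain F d where "finite F" "0 < d" "\<And>y. (\<And>i. i \<in> F \<Longrightarrow> \<bar>y i - z i\<bar> < d) \<Longrightarrow> \<bar>f y - f z\<bar> < inverse (real (Suc n))"
      using continuous_finitely_many_coordinates[OF f, of "inverse (real (Suc n))" z] by auto
    then show ?thesis by (intro exI[of _ F]) auto
  qed
  then obtain F where F: "\<And>n. finite (F n)"
      "\<And>n w. (\<forall>i\<in>F n. w i = z i) \<Longrightarrow> \<bar>f w - f z\<bar> < inverse (real (Suc n))" by metis
  show ?thesis
  proof (intro exI[of _ "\<Union>n. F n"] conjI allI impI)
    show "countable (\<Union>n. F n)" using F(1) by (auto intro: countable_finite)
    fix w assume w: "\<forall>i\<in>\<Union>n. F n. w i = z i"
    have "\<bar>f w - f z\<bar> < inverse (real (Suc n))" for n using F(2) w by auto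
    then have "\<not> 0 < \<bar>f w - f z\<bar>"
      using reals_Archimedean[of "\<bar>f w - f z\<bar>"] by (meson less_asym)
    then show "f w = f z" by simp
  qed
qed

text \<open>
  The points with finite support and rational entries, listed so that countability is inherited
  from the lists over a countable set.
\<close>
fun rational_point :: "('i \<times> rat) list \<Rightarrow> 'i \<Rightarrow> real" where
  "rational_point [] = (\<lambda>_. 0)"
| "rational_point ((i, q) # l) = (rational_point l)(i := of_rat q)"

lemma rational_point_approximation:
  assumes "finite F" "F \<subseteq> J" "0 < d"
  shows "\<exists>l \<in> lists (J \<times> UNIV). \<forall>i\<in>F. \<bar>rational_point l i - x i\<bar> < d"
  using assms(1,2)
proof (induction F)
  case empty then show ?case by (auto intro: bexI[of _ "[]"])
next
  case (insert i F)
  then obtain l where l: "l \<in> lists (J \<times> UNIV)" "\<forall>i\<in>F. \<bar>rational_point l i - x i\<bar> < d" by auto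
  obtain q where "x i - d < of_rat q" "of_rat q < x i + d"
    using of_rat_dense[of "x i - d" "x i + d"] assms(3) by auto
  then have "\<forall>k\<in>insert i F. \<bar>rational_point ((i, q) # l) k - x k\<bar> < d" using l by auto
  then show ?case using l insert.prems by (intro bexI[of _ "(i, q) # l"]) auto
qed

text \<open>
  Take J closed in this sense: for each rational point z supported in J, it contains the countable set of coordinates that
  the previous lemma attaches to z. If x and y agree on J, choose such a z near them
  on finitely many coordinates of J. The point that equals z on J and x elsewhere is close to x, and f
  takes the same value there as at z, because J contains all coordinates that matter at z.
  The same z serves for y, so f x and f y are both close to f z.
\<close>
lemma continuous_depends_on_countable:
  fixes f :: "('i \<Rightarrow> real) \<Rightarrow> real"
  assumes f: "continuous_on UNIV f"
  obtains J where "countable J" "depends_on f J"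
proof -
  obtain S where S: "\<And>z. countable (S z)" "\<And>z w. (\<forall>i\<in>S z. w i = z i) \<Longrightarrow> f w = f z"
    using continuous_countable_neighbourhood[OF f] by metis
  \<comment> \<open>This keeps J countable, because only countably many rational points have their support in a countable set.\<close>
  define step where "step J = J \<union> (\<Union>l\<in>lists (J \<times> (UNIV :: rat set)). S (rational_point l))" for J
  define JJ where "JJ n = (step ^^ n) {}" for n
  have JJ_Suc: "JJ (Suc n) = step (JJ n)" for n by (simp add: JJ_def)
  define J where "J = (\<Union>n. JJ n)"
  have "countable (JJ n)" for n
  proof (induction n)
    case 0 then show ?case by (simp add: JJ_def)
  next
    case (Suc n)
    have "countable (lists (JJ n \<times> (UNIV :: rat set)))" using Suc by auto
    then show ?case unfolding JJ_Suc step_def using S(1) Suc by auto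
  qed
  then have cJ: "countable J" by (simp add: J_def)
  have mono: "JJ m \<subseteq> JJ n" if "m \<le> n" for m n
    using that by (induction rule: dec_induct) (auto simp: JJ_Suc step_def)
  have closed: "S (rational_point l) \<subseteq> J" if l: "l \<in> lists (J \<times> UNIV)" for l
  proof -
    have "\<exists>n. l \<in> lists (JJ n \<times> UNIV)" using l
    proof (induction l)
      case Nil then show ?case by auto
    next
      case (Cons p l)
      then obtain n where n: "l \<in> lists (JJ n \<times> UNIV)" by auto
      obtain m where m: "fst p \<in> JJ m" using Cons.hyps(1) by (auto simp: J_def)
      have "l \<in> lists (JJ (max m n) \<times> UNIV)"
        using n mono[of n "max m n"] by (meson lists_mono max.cobounded2 Sigma_mono subsetD subset_refl)
      moreover have "p \<in> JJ (max m n) \<times> UNIV" using m mono[of m "max m n"] by (cases p) auto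
      ultimately show ?case by (intro exI[of _ "max m n"]) simp
    qed
    then obtain n where "l \<in> lists (JJ n \<times> UNIV)" by blast
    then have "S (rational_point l) \<subseteq> JJ (Suc n)" by (auto simp: JJ_Suc step_def)
    then show ?thesis by (auto simp: J_def)
  qed
  have "f x = f y" if xy: "\<forall>i\<in>J. x i = y i" for x y
  proof -
    have "\<bar>f x - f y\<bar> < 2 * e" if e: "0 < e" for e
    proof -
      obtain F d where F: "finite F" "0 < d" "\<And>w. (\<And>i. i \<in> F \<Longrightarrow> \<bar>w i - x i\<bar> < d) \<Longrightarrow> \<bar>f w - f x\<bar> < e"
        using continuous_finitely_many_coordinates[OF f e, of x] by metis
      obtain G d' where G: "finite G" "0 < d'" "\<And>w. (\<And>i. i \<in> G \<Longrightarrow> \<bar>w i - y i\<bar> < d') \<Longrightarrow> \<bar>f w - f y\<bar> < e"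
        using continuous_finitely_many_coordinates[OF f e, of y] by metis
      obtain l where l: "l \<in> lists (J \<times> UNIV)" "\<forall>i\<in>J \<inter> (F \<union> G). \<bar>rational_point l i - x i\<bar> < min d d'"
        using rational_point_approximation[of "J \<inter> (F \<union> G)" J "min d d'" x] F G by auto
      have on_S: "f (\<lambda>i. if i \<in> J then rational_point l i else t i) = f (rational_point l)" for t
        using closed[OF l(1)] by (intro S(2)) auto
      have "\<bar>f (\<lambda>i. if i \<in> J then rational_point l i else x i) - f x\<bar> < e"
        using l(2) F(2) by (intro F(3)) auto
      moreover have "\<bar>f (\<lambda>i. if i \<in> J then rational_point l i else y i) - f y\<bar> < e"
        using l(2) G(2) xy by (intro G(3)) auto
      ultimately show ?thesis using on_S by auto
    qed
    from this[of "\<bar>f x - f y\<bar> / 2"] show ?thesis by force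
  qed
  then show thesis using cJ that unfolding depends_on_def by blast
qed

section \<open>Lindelof sets miss a point in each uncountable power\<close>

lemma Lindelof_subcover:
  assumes "Lindelof_space (top_of_set X)" "\<And>U. U \<in> \<U> \<Longrightarrow> open U" "X \<subseteq> \<Union>\<U>"
  obtains W where "countable W" "W \<subseteq> \<U>" "X \<subseteq> \<Union>W"
proof -
  have "\<exists>W. countable W \<and> W \<subseteq> \<U> \<and> X \<subseteq> \<Union>W"
    using assms Lindelof_space_subtopology_subset[of X euclidean]
    unfolding open_openin[symmetric] by simp
  then show thesis using that by blast
qed

text \<open>
  An integer-valued point is not injective on the uncountable set P, so the open conditions
  "x i is not an integer" and \<bar>x i - x j\<bar> < 1 for i \<noteq> j cover everything. Countably many of these conditions
  mention countably many coordinates only, and a point with distinct integers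
  in those coordinates violates all of them.
\<close>
lemma Lindelof_coordinates_avoid_point:
  fixes X :: "('i \<Rightarrow> real) set"
  assumes X: "Lindelof_space (top_of_set X)" and P: "uncountable P"
  shows "\<exists>c. \<forall>x\<in>X. \<exists>i\<in>P. x i \<noteq> c i"
proof (rule ccontr)
  assume "\<not> ?thesis"
  then have hit: "\<And>c. \<exists>x\<in>X. \<forall>i\<in>P. x i = c i" by auto
  define V where "V p = (if fst p = snd p then {x. x (fst p) \<notin> (\<int> :: real set)}
      else {x :: 'i \<Rightarrow> real. \<bar>x (fst p) - x (snd p)\<bar> < 1})" for p
  have open_V: "open (V p)" for p
  proof -
    have "closed (\<int> :: real set)" by (rule closed_Ints)
    then have "open ((\<lambda>x :: 'i \<Rightarrow> real. x (fst p)) -` (- \<int>))"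
      by (intro open_vimage) (auto simp: continuous_on_product_coordinates)
    moreover have "open {x :: 'i \<Rightarrow> real. \<bar>x (fst p) - x (snd p)\<bar> < 1}"
      by (intro open_Collect_less continuous_intros continuous_on_product_coordinates)
    ultimately show ?thesis by (auto simp: V_def vimage_def)
  qed
  have cover: "X \<subseteq> (\<Union>p\<in>P \<times> P. V p)"
  proof
    fix x assume "x \<in> X"
    show "x \<in> (\<Union>p\<in>P \<times> P. V p)"
    proof (cases "\<forall>i\<in>P. x i \<in> \<int>")
      case False
      then obtain i where "i \<in> P" "x i \<notin> \<int>" by blast
      then show ?thesis by (auto simp: V_def intro!: bexI[of _ "(i,i)"])
    next
      case True
      have "\<not> inj_on x P"
      proof
        assume "inj_on x P"
        moreover have "countable (x ` P)"
          using True by (intro countable_subset[OF _ countable_int]) auto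
        ultimately show False using P countable_image_inj_on by blast
      qed
      then obtain i j where "i \<in> P" "j \<in> P" "i \<noteq> j" "x i = x j" by (auto simp: inj_on_def)
      then show ?thesis by (auto simp: V_def intro!: bexI[of _ "(i,j)"])
    qed
  qed
  obtain W where W: "countable W" "W \<subseteq> V ` (P \<times> P)" "X \<subseteq> \<Union>W"
  proof (rule Lindelof_subcover[OF X])
    show "\<And>U. U \<in> V ` (P \<times> P) \<Longrightarrow> open U" using open_V by blast
    show "X \<subseteq> \<Union>(V ` (P \<times> P))" by (rule cover)
  qed
  obtain Q where Q: "countable Q" "Q \<subseteq> P \<times> P" "W = V ` Q"
    using W(1,2) by (metis countable_subset_image)
  define N where "N = fst ` Q \<union> snd ` Q"
  have N: "countable N" "N \<subseteq> P" using Q by (auto simp: N_def)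
  obtain x where x: "x \<in> X" "\<forall>i\<in>P. x i = real (to_nat_on N i)"
    using hit[of "\<lambda>i. real (to_nat_on N i)"] by blast
  obtain p where p: "p \<in> Q" "x \<in> V p" using W(3) x(1) Q(3) by auto
  then have pN: "fst p \<in> N" "snd p \<in> N" by (auto simp: N_def)
  show False
  proof (cases "fst p = snd p")
    case True then show ?thesis using p x(2) pN N by (auto simp: V_def)
  next
    case False
    then have "to_nat_on N (fst p) \<noteq> to_nat_on N (snd p)"
      using pN N(1) by (simp add: to_nat_on_inj)
    moreover have "\<bar>real (to_nat_on N (fst p)) - real (to_nat_on N (snd p))\<bar> < 1"
    proof -
      have "fst p \<in> P" "snd p \<in> P" using pN N(2) by auto
      then show ?thesis using p(2) False x(2) by (simp add: V_def)
    qed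
    ultimately show ?thesis by linarith
  qed
qed

section \<open>Homogeneous gauges\<close>

lemma continuous_on_if_open_rays:
  fixes f :: "'a::topological_space \<Rightarrow> real"
  assumes less: "\<And>l. open {x. f x < l}" and greater: "\<And>l. open {x. l < f x}"
  shows "continuous_on UNIV f"
  unfolding continuous_on_def
proof (intro ballI order_tendstoI)
  fix x0 l assume "l < f x0"
  then show "\<forall>\<^sub>F x in at x0 within UNIV. l < f x"
    using greater[of l] by (auto simp: eventually_at_topological)
next
  fix x0 l assume "f x0 < l"
  then show "\<forall>\<^sub>F x in at x0 within UNIV. f x < l"
    using less[of l] by (auto simp: eventually_at_topological)
qed

text \<open>
  Used to remove the dependence of a function on a parameter in a compact interval: on a bounded
  coordinate, and on the scale of a dilation.
\<close>
lemma parametric_Sup: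
  fixes g :: "real \<Rightarrow> 'a::topological_space \<Rightarrow> real"
  assumes g: "continuous_on UNIV (\<lambda>(t, x). g t x)" and ab: "a \<le> b"
  shows parametric_Sup_attained: "\<exists>t\<in>{a..b}. (SUP t\<in>{a..b}. g t x) = g t x"
    and parametric_Sup_upper: "t \<in> {a..b} \<Longrightarrow> g t x \<le> (SUP t\<in>{a..b}. g t x)"
    and continuous_on_parametric_Sup: "continuous_on UNIV (\<lambda>x. SUP t\<in>{a..b}. g t x)"
proof -
  have attained: "\<exists>t\<in>{a..b}. (SUP t\<in>{a..b}. g t x) = g t x \<and> (\<forall>s\<in>{a..b}. g s x \<le> g t x)" for x
  proof -
    have "continuous_on {a..b} (\<lambda>t. (\<lambda>(t, x). g t x) (t, x))"
      by (intro continuous_on_compose2[OF g] continuous_intros) auto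
    then have "continuous_on {a..b} (\<lambda>t. g t x)" by simp
    then obtain t where t: "t \<in> {a..b}" "\<forall>s\<in>{a..b}. g s x \<le> g t x"
      using continuous_attains_sup[of "{a..b}" "\<lambda>t. g t x"] ab by auto
    then have "(SUP t\<in>{a..b}. g t x) = g t x" by (intro cSup_eq_maximum) auto
    then show ?thesis using t by blast
  qed
  show "\<exists>t\<in>{a..b}. (SUP t\<in>{a..b}. g t x) = g t x" using attained by blast
  show upper: "t \<in> {a..b} \<Longrightarrow> g t x \<le> (SUP t\<in>{a..b}. g t x)" for t x
    using attained[of x] by auto
  have less_iff: "(SUP t\<in>{a..b}. g t x) < l \<longleftrightarrow> (\<forall>t\<in>{a..b}. g t x < l)" for x l
    using attained[of x] by (metis order.strict_trans1)
  have greater_iff: "l < (SUP t\<in>{a..b}. g t x) \<longleftrightarrow> (\<exists>t\<in>{a..b}. l < g t x)" for x l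
    using attained[of x] by (metis order.strict_trans2)
  have open_less: "open {x. (SUP t\<in>{a..b}. g t x) < l}" for l
  proof (subst open_subopen, safe)
    fix x0 assume less: "(SUP t\<in>{a..b}. g t x0) < l"
    define W where "W = {(x, t). g t x < l}"
    have "open W"
    proof -
      have "continuous_on UNIV (\<lambda>p. (\<lambda>(t, x). g t x) (snd p, fst p))"
        by (intro continuous_on_compose2[OF g] continuous_intros) auto
      then have "open {p. (\<lambda>(t, x). g t x) (snd p, fst p) < l}"
        by (intro open_Collect_less continuous_on_const)
      moreover have "W = {p. (\<lambda>(t, x). g t x) (snd p, fst p) < l}" by (auto simp: W_def)
      ultimately show ?thesis by simp
    qed
    moreover have "{x0} \<times> {a..b} \<subseteq> W" using less by (auto simp: less_iff W_def)
    ultimately obtain U where "x0 \<in> U" "open U" "U \<times> {a..b} \<subseteq> W"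
      using Elementary_Topology.tube_lemma[of "{a..b}" W x0] by auto
    then show "\<exists>T. open T \<and> x0 \<in> T \<and> T \<subseteq> {x. (SUP t\<in>{a..b}. g t x) < l}"
      by (intro exI[of _ U]) (auto simp: less_iff W_def)
  qed
  have open_greater: "open {x. l < (SUP t\<in>{a..b}. g t x)}" for l
  proof -
    have "continuous_on UNIV (\<lambda>x. (\<lambda>(t, x). g t x) (t, x))" for t
      by (intro continuous_on_compose2[OF g] continuous_intros) auto
    then have "open (\<Union>t\<in>{a..b}. {x. l < g t x})"
      by (intro open_UN ballI open_Collect_less continuous_on_const) simp
    moreover have "(\<Union>t\<in>{a..b}. {x. l < g t x}) = {x. l < (SUP t\<in>{a..b}. g t x)}"
      by (auto simp: greater_iff)
    ultimately show ?thesis by simp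
  qed
  show "continuous_on UNIV (\<lambda>x. SUP t\<in>{a..b}. g t x)"
    by (rule continuous_on_if_open_rays[OF open_less open_greater])
qed

text \<open>
  Equivalent to X being completely separated from each disjoint zero set. In contrast to C-embeddedness,
  this property is obviously inherited by unions of two sets, and it is all that the
  flattening of X takes from C-embeddedness.
\<close>
definition separated_from_zero_sets :: "'a::topological_space set \<Rightarrow> bool"
  where "separated_from_zero_sets X \<longleftrightarrow>
    (\<forall>w :: 'a \<Rightarrow> real. continuous_on UNIV w \<longrightarrow> (\<forall>x\<in>X. 0 < w x) \<longrightarrow>
      (\<exists>H :: 'a \<Rightarrow> real. continuous_on UNIV H \<and> (\<forall>x\<in>X. 1 \<le> H x * w x)))"

definition scale_coordinates :: "'i set \<Rightarrow> ('i \<Rightarrow> real) \<Rightarrow> real \<Rightarrow> ('i \<Rightarrow> real) \<Rightarrow> 'i \<Rightarrow> real"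
  where "scale_coordinates L c t x = (\<lambda>i. if i \<in> L then c i + t * (x i - c i) else x i)"

lemma scale_scale [simp]:
  "scale_coordinates L c s (scale_coordinates L c t x) = scale_coordinates L c (s * t) x"
  by (auto simp: scale_coordinates_def fun_eq_iff)

lemma scale_1 [simp]: "scale_coordinates L c 1 x = x"
  by (auto simp: scale_coordinates_def fun_eq_iff)

lemma continuous_on_scale [continuous_intros]:
  assumes "continuous_on S (f :: 'a::topological_space \<Rightarrow> real)" "continuous_on S (g :: 'a \<Rightarrow> 'i \<Rightarrow> real)"
  shows "continuous_on S (\<lambda>z. scale_coordinates L c (f z) (g z))"
  unfolding scale_coordinates_def
proof (rule continuous_on_coordinatewise_then_product)
  fix i
  have "continuous_on S (\<lambda>z. g z i)" using assms(2) by (rule continuous_on_product_then_coordinatewise)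
  then show "continuous_on S (\<lambda>z. if i \<in> L then c i + f z * (g z i - c i) else g z i)"
    using assms(1) by (cases "i \<in> L") (auto intro!: continuous_intros)
qed

lemma depends_on_scale:
  assumes "depends_on f R" shows "depends_on (\<lambda>x. f (scale_coordinates L c t x)) R"
  unfolding depends_on_def
  by (auto intro!: depends_onD[OF assms] simp: scale_coordinates_def)

text \<open>
  The Minkowski functional of the set k < 1 relative to the dilations. Monotonicity of k along rays
  makes r < l equivalent to k < 1 at scale 1/l; strict monotonicity makes r > l equivalent to
  k > 1 at scale 1/l, and so there is no jump of r where k stays constant along a ray. Both conditions are open in x.
\<close>
lemma homogeneous_gauge:
  fixes k :: "('i \<Rightarrow> real) \<Rightarrow> real" and L :: "'i set" and c :: "'i \<Rightarrow> real"
  defines "S \<equiv> scale_coordinates L c"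
  assumes k: "continuous_on UNIV k" and dep: "depends_on k R"
    and zero: "\<And>x. k (S 0 x) < 1"
    and mono: "\<And>x s t. 0 < s \<Longrightarrow> s < t \<Longrightarrow> k (S s x) \<le> k (S t x)"
    and strict: "\<And>x s t. 0 < s \<Longrightarrow> s < t \<Longrightarrow> 0 < k (S s x) \<Longrightarrow> k (S s x) < k (S t x)"
  obtains r where "continuous_on UNIV r" "depends_on r R" "\<And>x. 0 \<le> r x"
    "\<And>x t. 0 < t \<Longrightarrow> r (S t x) = t * r x" "\<And>x. 1 \<le> k x \<Longrightarrow> 1 \<le> r x"
proof -
  define A where "A x = {l. 0 < l \<and> k (S (1 / l) x) < 1}" for x
  define r where "r x = Inf (A x)" for x
  have bdd: "bdd_below (A x)" for x by (rule bdd_belowI[of _ 0]) (auto simp: A_def)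
  have contk: "continuous_on UNIV (\<lambda>t. k (S t x))" for x
    unfolding S_def by (intro continuous_on_compose2[OF k] continuous_intros) auto
  have contkx: "continuous_on UNIV (\<lambda>x. k (S t x))" for t
    unfolding S_def by (intro continuous_on_compose2[OF k] continuous_intros continuous_on_id) auto
  have near: "\<exists>d>0. \<forall>s. \<bar>s - t\<bar> < d \<longrightarrow> \<bar>k (S s x) - k (S t x)\<bar> < e" if "0 < e" for x t e
    using contk[of x] that unfolding continuous_on_iff by (auto simp: dist_real_def)
  have ne: "A x \<noteq> {}" for x
  proof -
    obtain d where d: "0 < d" "\<And>s. \<bar>s - 0\<bar> < d \<Longrightarrow> \<bar>k (S s x) - k (S 0 x)\<bar> < 1 - k (S 0 x)"
      using near[of "1 - k (S 0 x)" 0 x] zero[of x] by auto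
    have "1 / (2 / d) = d / 2" by simp
    moreover have "\<bar>d / 2 - 0\<bar> < d" using d(1) by simp
    ultimately have "2 / d \<in> A x" using d(1) d(2)[of "d / 2"] by (auto simp: A_def)
    then show ?thesis by blast
  qed
  have mono': "k (S s x) \<le> k (S t x)" if "0 < s" "s \<le> t" for s t x
    using mono[of s t x] that by (cases "s = t") auto
  have less_iff: "r x < l \<longleftrightarrow> k (S (1 / l) x) < 1" if l: "0 < l" for x l
  proof
    assume "r x < l"
    then obtain m where m: "m \<in> A x" "m < l"
      unfolding r_def using cInf_less_iff[OF ne bdd] by blast
    then have "k (S (1 / l) x) \<le> k (S (1 / m) x)"
      using l by (intro mono') (auto simp: A_def field_simps)
    then show "k (S (1 / l) x) < 1" using m by (auto simp: A_def)
  next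
    assume less: "k (S (1 / l) x) < 1"
    obtain d where d: "0 < d" "\<And>s. \<bar>s - 1 / l\<bar> < d \<Longrightarrow> \<bar>k (S s x) - k (S (1 / l) x)\<bar> < 1 - k (S (1 / l) x)"
      using near[of "1 - k (S (1 / l) x)" "1 / l" x] less by auto
    define s where "s = 1 / l + d / 2"
    have "1 / s \<in> A x" using d(1) d(2)[of s] l by (auto simp: A_def s_def intro!: add_pos_pos)
    moreover have "1 / s < l"
    proof -
      have "1 / l < s" using d(1) by (simp add: s_def)
      moreover have "0 < s" using d(1) l by (auto simp: s_def intro!: add_pos_pos)
      ultimately show ?thesis using l by (simp add: field_simps)
    qed
    ultimately show "r x < l" unfolding r_def using cInf_less_iff[OF ne bdd] by blast
  qed
  have greater_iff: "l < r x \<longleftrightarrow> 1 < k (S (1 / l) x)" if l: "0 < l" for x l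
  proof
    assume lr: "l < r x"
    define m where "m = (l + r x) / 2"
    have m: "l < m" "m < r x" using lr by (auto simp: m_def)
    then have "1 \<le> k (S (1 / m) x)" using less_iff[of m x] l by auto
    moreover have "1 / m < 1 / l" "0 < 1 / m" using m l by (auto simp: field_simps)
    ultimately show "1 < k (S (1 / l) x)" using strict[of "1 / m" "1 / l" x] by linarith
  next
    assume gr: "1 < k (S (1 / l) x)"
    obtain d where d: "0 < d" "\<And>s. \<bar>s - 1 / l\<bar> < d \<Longrightarrow> \<bar>k (S s x) - k (S (1 / l) x)\<bar> < k (S (1 / l) x) - 1"
      using near[of "k (S (1 / l) x) - 1" "1 / l" x] gr by auto
    define s where "s = 1 / l - min (d / 2) (1 / (2 * l))"
    have s: "0 < s" "s < 1 / l" "\<bar>s - 1 / l\<bar> < d"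
      using d(1) l by (auto simp: s_def min_def field_simps)
    then have "1 < k (S (1 / (1 / s)) x)" using d(2)[of s] by auto
    then have "\<not> r x < 1 / s" using less_iff[of "1 / s" x] s by auto
    moreover have "l < 1 / s" using s l by (simp add: field_simps)
    ultimately show "l < r x" by linarith
  qed
  have nonneg: "0 \<le> r x" for x
    unfolding r_def by (rule cInf_greatest[OF ne]) (auto simp: A_def)
  have "continuous_on UNIV r"
  proof (rule continuous_on_if_open_rays)
    fix l
    show "open {x. r x < l}"
    proof (cases "0 < l")
      case True
      then show ?thesis using less_iff by (auto intro!: open_Collect_less contkx continuous_on_const)
    next
      case False
      have "\<not> r x < l" for x using nonneg[of x] False by linarith
      then show ?thesis by simp
    qed
    have pos: "open {x. l < r x}" if "0 < l" for l
      using greater_iff that by (auto intro!: open_Collect_less contkx continuous_on_const)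
    show "open {x. l < r x}"
    proof (cases "0 \<le> l")
      case True
      have "{x. l < r x} = (\<Union>m\<in>{l<..}. {x. m < r x})" using dense by fastforce
      moreover have "open (\<Union>m\<in>{l<..}. {x. m < r x})"
        using pos True by (intro open_UN ballI) auto
      ultimately show ?thesis by simp
    next
      case False
      then have "l < r x" for x using nonneg[of x] by linarith
      then show ?thesis by simp
    qed
  qed
  moreover have "depends_on r R"
    unfolding depends_on_def
  proof (intro allI impI)
    fix x y :: "'i \<Rightarrow> real" assume "\<forall>i\<in>R. x i = y i"
    then have "k (S t x) = k (S t y)" for t
      using depends_onD[OF depends_on_scale[OF dep, of L c t], of x y] by (auto simp: S_def)
    then show "r x = r y" by (simp add: r_def A_def)
  qed
  moreover have "r (S t x) = t * r x" if t: "0 < t" for x t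
  proof -
    have eq: "r (S t x) < l \<longleftrightarrow> t * r x < l" if l: "0 < l" for l
    proof -
      have "r (S t x) < l \<longleftrightarrow> k (S (1 / l) (S t x)) < 1" by (rule less_iff[OF l])
      also have "S (1 / l) (S t x) = S (1 / (l / t)) x" by (simp add: S_def)
      also have "k (S (1 / (l / t)) x) < 1 \<longleftrightarrow> r x < l / t" using l t by (intro less_iff[symmetric]) auto
      also have "\<dots> \<longleftrightarrow> t * r x < l" using t by (simp add: field_simps)
      finally show ?thesis .
    qed
    have "0 \<le> t * r x" using t nonneg[of x] by simp
    then show ?thesis using eq nonneg[of "S t x"]
      by (metis dual_order.strict_iff_not linorder_neq_iff order_le_less_trans)
  qed
  moreover have "1 \<le> r x" if "1 \<le> k x" for x
    using less_iff[of 1 x] that by (auto simp: S_def)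
  ultimately show thesis using that nonneg by blast
qed

text \<open>
  A bounded substitute for the absolute value that is still strictly increasing on rays, which
  a truncation of the absolute value would not be.
\<close>
definition saturate :: "real \<Rightarrow> real" where "saturate z = \<bar>z\<bar> / (1 + \<bar>z\<bar>)"

lemma saturate_simps [simp]: "saturate 0 = 0" "0 \<le> saturate z" "saturate z \<le> 1" "0 < saturate z \<longleftrightarrow> z \<noteq> 0"
  by (auto simp: saturate_def field_simps)

lemma saturate_scale_strict:
  assumes "0 \<le> s" "s < t" "z \<noteq> 0" shows "saturate (s * z) < saturate (t * z)"
proof -
  have "s * \<bar>z\<bar> < t * \<bar>z\<bar>" "0 \<le> s * \<bar>z\<bar>" using assms by auto
  then have "s * \<bar>z\<bar> / (1 + s * \<bar>z\<bar>) < t * \<bar>z\<bar> / (1 + t * \<bar>z\<bar>)" by (simp add: field_simps)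
  then show ?thesis using assms by (simp add: saturate_def abs_mult)
qed

lemma saturate_scale_mono: "0 \<le> s \<Longrightarrow> s < t \<Longrightarrow> saturate (s * z) \<le> saturate (t * z)"
  using saturate_scale_strict[of s t z] by (cases "z = 0") auto

text \<open>
  A continuous function whose zeros are exactly the points that agree with c in the coordinates e 0, e 1, ...
\<close>
definition weighted_distance :: "(nat \<Rightarrow> 'i) \<Rightarrow> ('i \<Rightarrow> real) \<Rightarrow> ('i \<Rightarrow> real) \<Rightarrow> real"
  where "weighted_distance e c x = (\<Sum>n. (1/2)^n * saturate (x (e n) - c (e n)))"

lemma saturate_geometric_bound: "norm ((1/2)^n * saturate z) \<le> (1/2 :: real)^n"
  by (simp add: abs_mult mult_left_le)

lemma summable_saturate: "summable (\<lambda>n. (1/2)^n * saturate (f n))"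
  by (rule summable_comparison_test[OF _ summable_geometric[of "1/2 :: real"]])
    (use saturate_geometric_bound in auto)

lemma continuous_weighted_distance: "continuous_on UNIV (weighted_distance e c)"
proof -
  define h where "h n x = (1/2)^n * saturate (x (e n) - c (e n))" for n and x :: "'a \<Rightarrow> real"
  have "uniform_limit UNIV (\<lambda>n x. \<Sum>i<n. h i x) (\<lambda>x. \<Sum>i. h i x) sequentially"
    using saturate_geometric_bound unfolding h_def
    by (intro Weierstrass_m_test[of UNIV _ "\<lambda>n. (1/2)^n"] summable_geometric) auto
  moreover have "continuous_on UNIV (h n)" for n
    unfolding h_def saturate_def
    by (intro continuous_intros continuous_on_product_coordinates) (auto simp: add_nonneg_eq_0_iff)
  then have "\<forall>\<^sub>F n in sequentially. continuous_on UNIV (\<lambda>x. \<Sum>i<n. h i x)"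
    by (intro always_eventually allI continuous_on_sum) auto
  ultimately have "continuous_on UNIV (\<lambda>x. \<Sum>i. h i x)"
    by (intro uniform_limit_theorem) auto
  then show ?thesis by (simp add: weighted_distance_def[abs_def] h_def)
qed

lemma weighted_distance_nonneg: "0 \<le> weighted_distance e c x"
  unfolding weighted_distance_def by (intro suminf_nonneg summable_saturate) auto

lemma weighted_distance_pos_iff: "0 < weighted_distance e c x \<longleftrightarrow> (\<exists>n. x (e n) \<noteq> c (e n))"
proof
  assume "\<exists>n. x (e n) \<noteq> c (e n)"
  then obtain n where "x (e n) \<noteq> c (e n)" ..
  then show "0 < weighted_distance e c x"
    unfolding weighted_distance_def by (intro suminf_pos2[OF summable_saturate, of _ n]) auto
next
  assume pos: "0 < weighted_distance e c x"
  show "\<exists>n. x (e n) \<noteq> c (e n)"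
  proof (rule ccontr)
    assume "\<not> ?thesis"
    then have "weighted_distance e c x = 0" by (simp add: weighted_distance_def)
    with pos show False by simp
  qed
qed

lemma weighted_distance_scale:
  assumes "range e \<subseteq> L"
  shows "weighted_distance e c (scale_coordinates L c t x) = (\<Sum>n. (1/2)^n * saturate (t * (x (e n) - c (e n))))"
proof -
  have "e n \<in> L" for n using assms by auto
  then show ?thesis by (simp add: weighted_distance_def scale_coordinates_def)
qed

lemma weighted_distance_scale_mono:
  assumes "range e \<subseteq> L" "0 \<le> s" "s < t"
  shows "weighted_distance e c (scale_coordinates L c s x) \<le> weighted_distance e c (scale_coordinates L c t x)"
  unfolding weighted_distance_scale[OF assms(1)]
  by (intro suminf_le summable_saturate mult_left_mono saturate_scale_mono assms(2,3)) auto

lemma weighted_distance_scale_strict: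
  assumes "range e \<subseteq> L" "0 \<le> s" "s < t" "0 < weighted_distance e c x"
  shows "weighted_distance e c (scale_coordinates L c s x) < weighted_distance e c (scale_coordinates L c t x)"
proof -
  obtain m where m: "x (e m) \<noteq> c (e m)" using assms(4) by (auto simp: weighted_distance_pos_iff)
  let ?h = "\<lambda>s n. (1/2)^n * saturate (s * (x (e n) - c (e n)))"
  have "0 < (\<Sum>n. ?h t n - ?h s n)"
  proof (rule suminf_pos2[of _ m])
    show "summable (\<lambda>n. ?h t n - ?h s n)" by (intro summable_diff summable_saturate)
    show "0 \<le> ?h t n - ?h s n" for n
      using saturate_scale_mono[OF assms(2,3), of "x (e n) - c (e n)"] by (simp add: mult_left_mono)
    show "0 < ?h t m - ?h s m"
      using saturate_scale_strict[OF assms(2,3), of "x (e m) - c (e m)"] m by simp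
  qed
  also have "\<dots> = (\<Sum>n. ?h t n) - (\<Sum>n. ?h s n)"
    by (intro suminf_diff[symmetric] summable_saturate)
  finally show ?thesis unfolding weighted_distance_scale[OF assms(1)] by simp
qed

lemma weighted_distance_scale_0:
  "range e \<subseteq> L \<Longrightarrow> weighted_distance e c (scale_coordinates L c 0 x) = 0"
  by (simp add: weighted_distance_scale)

lemma depends_on_weighted_distance: "depends_on (weighted_distance e c) (range e)"
  by (auto simp: depends_on_def weighted_distance_def)

text \<open>
  The product H * w need not increase along rays because H is arbitrary. Replacing H by its maximum over
  all smaller dilations repairs this without destroying the lower bound on X,
  and the strict growth of the weight w is inherited by the product.
\<close>
lemma gauge_from_weight:
  fixes H :: "('i \<Rightarrow> real) \<Rightarrow> real" and e :: "nat \<Rightarrow> 'i" and c :: "'i \<Rightarrow> real"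
  defines "w \<equiv> weighted_distance e c"
  assumes H: "continuous_on UNIV H" "\<And>x. 1 \<le> H x" "depends_on H R" and e: "range e \<subseteq> L" "range e \<subseteq> R"
    and X: "\<And>x. x \<in> X \<Longrightarrow> 1 \<le> H x * w x"
  obtains r where "continuous_on UNIV r" "depends_on r R" "\<And>x. 0 \<le> r x"
    "\<And>x t. 0 < t \<Longrightarrow> r (scale_coordinates L c t x) = t * r x" "\<And>x. x \<in> X \<Longrightarrow> 1 \<le> r x"
proof -
  define S where "S = scale_coordinates L c"
  define M where "M x = (SUP s\<in>{0..1}. H (S s x))" for x
  have contH: "continuous_on UNIV (\<lambda>(s, x). H (S s x))"
    unfolding case_prod_beta S_def
    by (intro continuous_on_compose2[OF H(1)] continuous_intros) auto
  note att = parametric_Sup_attained[OF contH zero_le_one]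
    and up = parametric_Sup_upper[OF contH zero_le_one]
    and contM = continuous_on_parametric_Sup[OF contH zero_le_one]
  have M1: "1 \<le> M x" for x
    using att[of x] H(2) unfolding M_def by (metis)
  have HM: "H x \<le> M x" for x
    using up[of 1 x] by (simp add: M_def S_def)
  have Mmono: "M (S s x) \<le> M (S t x)" if "0 < s" "s < t" for s t x
  proof -
    obtain q where q: "q \<in> {0..1}" "M (S s x) = H (S q (S s x))"
      using att[of "S s x"] unfolding M_def by blast
    have "S q (S s x) = S (q * s / t) (S t x)" using that by (simp add: S_def)
    moreover have "q * s / t \<in> {0..1}"
    proof -
      have "q * s \<le> 1 * t" using q(1) that by (intro mult_mono) auto
      then show ?thesis using q(1) that by (simp add: field_simps)
    qed
    ultimately show ?thesis using q(2) up[of "q * s / t" "S t x"] by (simp add: M_def)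
  qed
  define k where "k x = w x * M x" for x
  have wpos: "0 < w x" if "0 < w (S s x)" for x s
  proof -
    obtain n where n: "S s x (e n) \<noteq> c (e n)" using \<open>0 < w (S s x)\<close> by (auto simp: w_def weighted_distance_pos_iff)
    then have "x (e n) \<noteq> c (e n)" by (auto simp: S_def scale_coordinates_def split: if_splits)
    then show ?thesis by (auto simp: w_def weighted_distance_pos_iff)
  qed
  obtain r where r: "continuous_on UNIV r" "depends_on r R" "\<And>x. 0 \<le> r x"
    "\<And>x t. 0 < t \<Longrightarrow> r (scale_coordinates L c t x) = t * r x" "\<And>x. 1 \<le> k x \<Longrightarrow> 1 \<le> r x"
  proof (rule homogeneous_gauge[of k R L c])
    show "continuous_on UNIV k" unfolding k_def w_def M_def
      by (intro continuous_intros continuous_weighted_distance contM)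
    show "depends_on k R"
      unfolding depends_on_def
    proof (intro allI impI)
      fix x y :: "'i \<Rightarrow> real" assume xy: "\<forall>i\<in>R. x i = y i"
      have "H (S s x) = H (S s y)" for s
        using depends_onD[OF depends_on_scale[OF H(3), of L c s], of x y] xy by (auto simp: S_def)
      moreover have "w x = w y"
        unfolding w_def using xy e(2) by (intro depends_onD[OF depends_on_weighted_distance]) auto
      ultimately show "k x = k y" by (simp add: k_def M_def)
    qed
    show "k (scale_coordinates L c 0 x) < 1" for x
      using weighted_distance_scale_0[OF e(1)] by (simp add: k_def w_def)
    show "k (scale_coordinates L c s x) \<le> k (scale_coordinates L c t x)" if "0 < s" "s < t" for s t x
      unfolding k_def
    proof (rule mult_mono)
      show "w (scale_coordinates L c s x) \<le> w (scale_coordinates L c t x)"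
        unfolding w_def using that by (intro weighted_distance_scale_mono[OF e(1)]) auto
      show "M (scale_coordinates L c s x) \<le> M (scale_coordinates L c t x)"
        using Mmono[OF that] by (simp add: S_def)
      show "0 \<le> w (scale_coordinates L c t x)" "0 \<le> M (scale_coordinates L c s x)"
        using M1[of "scale_coordinates L c s x"] by (auto simp: w_def weighted_distance_nonneg)
    qed
    show "k (scale_coordinates L c s x) < k (scale_coordinates L c t x)"
      if "0 < s" "s < t" "0 < k (scale_coordinates L c s x)" for s t x
      unfolding k_def
    proof (rule mult_less_le_imp_less)
      have "0 < w (S s x)"
        using that(3) M1[of "S s x"] by (auto simp: k_def S_def zero_less_mult_iff)
      then have "0 < w x" using wpos by blast
      then show "w (scale_coordinates L c s x) < w (scale_coordinates L c t x)"
        unfolding w_def using that by (intro weighted_distance_scale_strict[OF e(1)]) auto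
      show "M (scale_coordinates L c s x) \<le> M (scale_coordinates L c t x)"
        using Mmono[OF that(1,2)] by (simp add: S_def)
      show "0 \<le> w (scale_coordinates L c s x)" by (simp add: w_def weighted_distance_nonneg)
      show "0 < M (scale_coordinates L c s x)" using M1[of "scale_coordinates L c s x"] by linarith
    qed
  qed blast
  have "1 \<le> r x" if "x \<in> X" for x
  proof (rule r(5))
    have "1 \<le> H x * w x" using X that by blast
    also have "\<dots> \<le> M x * w x" by (intro mult_right_mono HM) (simp add: w_def weighted_distance_nonneg)
    finally show "1 \<le> k x" by (simp add: k_def mult.commute)
  qed
  then show thesis using that r by blast
qed

text \<open>
  Every point of X differs from c somewhere in P; by the Lindelof property countably many coordinates detect
  this, so a weighted distance from c is positive on X and has a continuous upper bound
  H for its reciprocal there.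
\<close>
lemma weight_positive_on:
  fixes X :: "('i \<Rightarrow> real) set"
  assumes X: "Lindelof_space (top_of_set X)" "separated_from_zero_sets X" and P: "uncountable P"
  obtains e c H R where "range e \<subseteq> P" "continuous_on UNIV H" "\<And>x. 1 \<le> H x"
    "countable R" "depends_on H R" "range e \<subseteq> R" "\<And>x. x \<in> X \<Longrightarrow> 1 \<le> H x * weighted_distance e c x"
proof -
  obtain c where c: "\<And>x. x \<in> X \<Longrightarrow> \<exists>i\<in>P. x i \<noteq> c i"
    using Lindelof_coordinates_avoid_point[OF X(1) P] by blast
  define V where "V i = {x :: 'i \<Rightarrow> real. x i \<noteq> c i}" for i
  obtain W where W: "countable W" "W \<subseteq> V ` P" "X \<subseteq> \<Union>W"
  proof (rule Lindelof_subcover[OF X(1)])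
    fix U assume "U \<in> V ` P"
    then show "open U"
      by (auto simp: V_def intro!: open_Collect_neq continuous_on_product_coordinates continuous_on_const)
  next
    show "X \<subseteq> \<Union>(V ` P)" using c by (auto simp: V_def)
  qed
  obtain Q where Q: "countable Q" "Q \<subseteq> P" "W = V ` Q" using W(1,2) by (metis countable_subset_image)
  obtain p where p: "p \<in> P" using P by fastforce
  define e where "e = from_nat_into (insert p Q)"
  have e: "range e = insert p Q"
    unfolding e_def using Q(1) by (intro range_from_nat_into) auto
  have "continuous_on UNIV (weighted_distance e c)" by (rule continuous_weighted_distance)
  moreover have "\<forall>x\<in>X. 0 < weighted_distance e c x"
  proof
    fix x assume "x \<in> X"
    then obtain i where i: "i \<in> Q" "x i \<noteq> c i" using W(3) Q(3) by (auto simp: V_def)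
    then obtain n where "e n = i" using e by (metis insertCI rangeE)
    then show "0 < weighted_distance e c x" using i(2) by (auto simp: weighted_distance_pos_iff)
  qed
  ultimately obtain H0 where H0: "continuous_on UNIV H0" "\<forall>x\<in>X. 1 \<le> H0 x * weighted_distance e c x"
    using X(2) unfolding separated_from_zero_sets_def by blast
  define H where "H x = max 1 (H0 x)" for x
  have H: "continuous_on UNIV H" unfolding H_def by (intro continuous_intros H0(1))
  obtain R where R: "countable R" "depends_on H R" using continuous_depends_on_countable[OF H] .
  show thesis
  proof (rule that[of e H "R \<union> range e" c])
    show "range e \<subseteq> P" using e Q p by auto
    show "depends_on H (R \<union> range e)" by (rule depends_on_mono[OF R(2)]) auto
    fix x assume "x \<in> X"
    then have "1 \<le> H0 x * weighted_distance e c x" using H0(2) by blast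
    also have "\<dots> \<le> H x * weighted_distance e c x"
      by (intro mult_right_mono weighted_distance_nonneg) (simp add: H_def)
    finally show "1 \<le> H x * weighted_distance e c x" .
  qed (use H R in \<open>auto simp: H_def\<close>)
qed

lemma gauge_exists:
  fixes X :: "('i \<Rightarrow> real) set"
  assumes X: "Lindelof_space (top_of_set X)" "separated_from_zero_sets X" and P: "uncountable P"
  obtains L c r R where "L \<subseteq> P" "countable R" "L \<subseteq> R" "continuous_on UNIV r" "depends_on r R"
    "\<And>x. 0 \<le> r x" "\<And>x t. 0 < t \<Longrightarrow> r (scale_coordinates L c t x) = t * r x" "\<And>x. x \<in> X \<Longrightarrow> 1 \<le> r x"
proof -
  obtain e c H R where *: "range e \<subseteq> P" "continuous_on UNIV H" "\<And>x. 1 \<le> H x"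
    "countable R" "depends_on H R" "range e \<subseteq> R" "\<And>x. x \<in> X \<Longrightarrow> 1 \<le> H x * weighted_distance e c x"
    using weight_positive_on[OF X P] by metis
  obtain r where "continuous_on UNIV r" "depends_on r R" "\<And>x. 0 \<le> r x"
    "\<And>x t. 0 < t \<Longrightarrow> r (scale_coordinates (range e) c t x) = t * r x" "\<And>x. x \<in> X \<Longrightarrow> 1 \<le> r x"
    using gauge_from_weight[OF *(2,3,5) order_refl *(6) *(7)] by blast
  then show thesis using that[of "range e" R r c] *(1,4,6) by blast
qed

text \<open>
  Later steps share the coordinate u, so their gauges must not depend on it. As u is bounded on
  X, the maximum over the possible values of u can take the place of H.
\<close>
lemma gauge_exists_bounded_coordinate:
  fixes X :: "('i \<Rightarrow> real) set"
  assumes X: "Lindelof_space (top_of_set X)" "separated_from_zero_sets X" and P: "uncountable P"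
    and u: "u \<notin> P" and a: "\<And>x. x \<in> X \<Longrightarrow> \<bar>x u\<bar> \<le> a" "0 \<le> a"
  obtains L c r R where "L \<subseteq> P" "countable R" "L \<subseteq> R" "u \<notin> R" "continuous_on UNIV r" "depends_on r R"
    "\<And>x. 0 \<le> r x" "\<And>x t. 0 < t \<Longrightarrow> r (scale_coordinates L c t x) = t * r x" "\<And>x. x \<in> X \<Longrightarrow> 1 \<le> r x"
proof -
  obtain e c H R where *: "range e \<subseteq> P" "continuous_on UNIV H" "\<And>x. 1 \<le> H x"
    "countable R" "depends_on H R" "range e \<subseteq> R" "\<And>x. x \<in> X \<Longrightarrow> 1 \<le> H x * weighted_distance e c x"
    using weight_positive_on[OF X P] by metis
  define M where "M x = (SUP b\<in>{-a..a}. H (x(u := b)))" for x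
  have cont_upd: "continuous_on UNIV (\<lambda>p :: real \<times> ('i \<Rightarrow> real). (snd p)(u := fst p))"
    unfolding fun_upd_def
  proof (rule continuous_on_coordinatewise_then_product)
    fix i
    have "continuous_on UNIV (\<lambda>p :: real \<times> ('i \<Rightarrow> real). snd p i)"
      by (rule continuous_on_product_then_coordinatewise) (intro continuous_intros)
    then show "continuous_on UNIV (\<lambda>p :: real \<times> ('i \<Rightarrow> real). if i = u then fst p else snd p i)"
      by (cases "i = u") (auto intro!: continuous_intros)
  qed
  have cont: "continuous_on UNIV (\<lambda>(b, x). H (x(u := b)))"
    unfolding case_prod_beta by (intro continuous_on_compose2[OF *(2) cont_upd]) auto
  have aa: "- a \<le> a" using a(2) by simp
  note att = parametric_Sup_attained[OF cont aa]
    and up = parametric_Sup_upper[OF cont aa]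
    and contM = continuous_on_parametric_Sup[OF cont aa]
  have M: "continuous_on UNIV M" using contM by (simp add: M_def[abs_def])
  have M1: "1 \<le> M x" for x using att[of x] *(3) unfolding M_def by metis
  have dep: "depends_on M (R - {u})"
    unfolding depends_on_def
  proof (intro allI impI)
    fix x y :: "'i \<Rightarrow> real" assume xy: "\<forall>i\<in>R - {u}. x i = y i"
    have "H (x(u := b)) = H (y(u := b))" for b
      using xy by (intro depends_onD[OF *(5)]) auto
    then show "M x = M y" by (simp add: M_def)
  qed
  have eR: "range e \<subseteq> R - {u}" using *(1,6) u by auto
  have MX: "1 \<le> M x * weighted_distance e c x" if x: "x \<in> X" for x
  proof -
    have "1 \<le> H x * weighted_distance e c x" using *(7) x by blast
    also have "H x \<le> M x"
      using up[of "x u" x] a(1)[OF x] by (auto simp: M_def abs_le_iff)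
    then have "H x * weighted_distance e c x \<le> M x * weighted_distance e c x"
      by (intro mult_right_mono weighted_distance_nonneg)
    finally show ?thesis .
  qed
  obtain r where "continuous_on UNIV r" "depends_on r (R - {u})" "\<And>x. 0 \<le> r x"
    "\<And>x t. 0 < t \<Longrightarrow> r (scale_coordinates (range e) c t x) = t * r x" "\<And>x. x \<in> X \<Longrightarrow> 1 \<le> r x"
    using gauge_from_weight[OF M M1 dep order_refl eR MX] by blast
  then show thesis using that[of "range e" "R - {u}" r c] *(1,4) eR by blast
qed

section \<open>One step: storing a coordinate in another one\<close>

text \<open>
  Infinitely many steps with the same u will follow one another, and it is the last condition, that the inverse is
  nonexpanding in u, which makes their composition invertible. The set R excludes u because every step changes u,
  while the other coordinates at which a step looks are to keep their values afterwards.
\<close>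
definition carry_step :: "'i \<Rightarrow> 'i set \<Rightarrow> 'i set \<Rightarrow> (('i \<Rightarrow> real) \<Rightarrow> 'i \<Rightarrow> real) \<Rightarrow> (('i \<Rightarrow> real) \<Rightarrow> 'i \<Rightarrow> real) \<Rightarrow> bool"
  where "carry_step u D R T T' \<longleftrightarrow>
    continuous_on UNIV T \<and> continuous_on UNIV T' \<and> (\<forall>x. T' (T x) = x) \<and> (\<forall>x. T (T' x) = x) \<and>
    u \<notin> R \<and> D \<subseteq> R \<and> (\<forall>x i. i \<notin> insert u D \<longrightarrow> T x i = x i) \<and>
    (\<forall>i\<in>insert u D. depends_on (\<lambda>x. T x i) (insert u R) \<and> depends_on (\<lambda>x. T' x i) (insert u R)) \<and>
    (\<forall>y s t. \<bar>T' (y(u := s)) u - T' (y(u := t)) u\<bar> \<le> \<bar>s - t\<bar>)"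

definition clip :: "real \<Rightarrow> real \<Rightarrow> real" where "clip a t = max (- a) (min a t)"

lemma continuous_on_clip [continuous_intros]:
  "continuous_on S f \<Longrightarrow> continuous_on S (\<lambda>x. clip a (f x))"
  unfolding clip_def by (intro continuous_intros)

lemma clip_id: "\<bar>t\<bar> \<le> a \<Longrightarrow> clip a t = t" by (auto simp: clip_def)

lemma clip_bound: "0 \<le> a \<Longrightarrow> \<bar>clip a t\<bar> \<le> a" by (auto simp: clip_def)

lemma clip_slope: "s \<le> t \<Longrightarrow> 0 \<le> clip a t - clip a s \<and> clip a t - clip a s \<le> t - s"
  by (auto simp: clip_def)

text \<open>
  The larger of 1 and ln (r x) + \<bar>x v\<bar>, written so that it is visibly continuous where r vanishes.
\<close>
definition level :: "(('i \<Rightarrow> real) \<Rightarrow> real) \<Rightarrow> 'i \<Rightarrow> ('i \<Rightarrow> real) \<Rightarrow> real"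
  where "level r v x = ln (max (exp 1) (r x * exp \<bar>x v\<bar>))"

text \<open>
  Three shears at constant level m, with v measured in units of m and u in units of \<epsilon>: subtract v from u, add u to v,
  subtract v from u. Without the cut-offs clip and q this is a quarter turn, which takes
  (u, v) to (-v, u). The dilation of L by exp (\<bar>v\<bar> - \<bar>b\<bar>) compensates the change of v to b in the level. The first shear
  is cut off at 1, because \<bar>v\<bar> \<le> m on X; the cut-off q of the last one is chosen by each step.
\<close>
definition shear_forward where
  "shear_forward u v L c r \<epsilon> q x =
    (let m = level r v x; a = x u - \<epsilon> * clip 1 (x v / m); b = x v + m / \<epsilon> * a
     in (scale_coordinates L c (exp (\<bar>x v\<bar> - \<bar>b\<bar>)) x)(u := a - \<epsilon> * q (b / m), v := b))"

definition shear_backward where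
  "shear_backward u v L c r \<epsilon> q y =
    (let m = level r v y; a = y u + \<epsilon> * q (y v / m); b = y v - m / \<epsilon> * a
     in (scale_coordinates L c (exp (\<bar>y v\<bar> - \<bar>b\<bar>)) y)(u := a + \<epsilon> * clip 1 (b / m), v := b))"

lemma level_ge_1: "1 \<le> level r v x"
proof -
  have "ln (exp 1) \<le> ln (max (exp 1) (r x * exp \<bar>x v\<bar>))" by (subst ln_le_cancel_iff) (auto simp: less_max_iff_disj)
  then show ?thesis by (simp add: level_def)
qed

text \<open>
  The point of using the level as a unit for v: where the gauge is at least 1, the quotient v / m is bounded.
\<close>
lemma level_ge_abs:
  assumes "1 \<le> r x" shows "\<bar>x v\<bar> \<le> level r v x"
proof -
  have "1 * exp \<bar>x v\<bar> \<le> r x * exp \<bar>x v\<bar>" using assms by (intro mult_right_mono) auto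
  then have "ln (exp \<bar>x v\<bar>) \<le> ln (max (exp 1) (r x * exp \<bar>x v\<bar>))"
    by (subst ln_le_cancel_iff) (auto simp: less_max_iff_disj le_max_iff_disj)
  then show ?thesis by (simp add: level_def)
qed

lemma continuous_on_level:
  assumes "continuous_on UNIV r" shows "continuous_on UNIV (level r v)"
proof -
  have "0 < max (exp 1) (r x * exp \<bar>x v\<bar>)" for x by (auto simp: less_max_iff_disj)
  then show ?thesis unfolding level_def
    by (intro continuous_intros assms continuous_on_product_coordinates) (auto simp: less_le)
qed

lemma continuous_on_fun_upd:
  fixes g :: "'a::topological_space \<Rightarrow> 'i \<Rightarrow> real"
  assumes "continuous_on S f" "continuous_on S g"
  shows "continuous_on S (\<lambda>x. (g x)(u := f x))"
  unfolding fun_upd_def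
proof (rule continuous_on_coordinatewise_then_product)
  fix i show "continuous_on S (\<lambda>x. if i = u then f x else g x i)"
    using assms continuous_on_product_then_coordinatewise[OF assms(2), of i] by (cases "i = u") auto
qed

locale shear =
  fixes u v :: 'i and L :: "'i set" and c :: "'i \<Rightarrow> real" and r :: "('i \<Rightarrow> real) \<Rightarrow> real"
    and R :: "'i set" and \<epsilon> :: real and q :: "real \<Rightarrow> real"
  assumes uv: "u \<noteq> v" "u \<notin> R" "v \<notin> R" and L: "L \<subseteq> R"
    and r: "continuous_on UNIV r" "depends_on r R" "\<And>x t. 0 < t \<Longrightarrow> r (scale_coordinates L c t x) = t * r x"
    and \<epsilon>: "0 < \<epsilon>" and q: "continuous_on UNIV q"
begin

abbreviation "T \<equiv> shear_forward u v L c r \<epsilon> q"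
abbreviation "T' \<equiv> shear_backward u v L c r \<epsilon> q"

lemma level_moved:
  "level r v ((scale_coordinates L c (exp (\<bar>x v\<bar> - \<bar>b\<bar>)) x)(u := a, v := b)) = level r v x"
proof -
  have "r ((scale_coordinates L c (exp (\<bar>x v\<bar> - \<bar>b\<bar>)) x)(u := a, v := b))
      = r (scale_coordinates L c (exp (\<bar>x v\<bar> - \<bar>b\<bar>)) x)"
    using uv by (intro depends_onD[OF r(2)]) auto
  also have "\<dots> = exp (\<bar>x v\<bar> - \<bar>b\<bar>) * r x" by (rule r(3)) simp
  finally show ?thesis by (simp add: level_def exp_diff mult.commute)
qed

lemma level_forward: "level r v (T x) = level r v x"
  unfolding shear_forward_def Let_def by (rule level_moved)

lemma level_backward: "level r v (T' x) = level r v x"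
  unfolding shear_backward_def Let_def by (rule level_moved)

lemma scale_moved_back:
  assumes "0 < s" "s * t = 1"
  shows "(scale_coordinates L c s ((scale_coordinates L c t x)(u := a, v := b)))(u := x u, v := x v) = x"
proof
  fix i
  have "u \<notin> L" "v \<notin> L" using uv L by auto
  moreover have "c i + s * t * (x i - c i) = x i" using assms by simp
  ultimately show "((scale_coordinates L c s ((scale_coordinates L c t x)(u := a, v := b)))(u := x u, v := x v)) i = x i"
    by (auto simp: scale_coordinates_def mult.assoc[symmetric])
qed

lemma backward_forward: "T' (T x) = x"
proof -
  define m where "m = level r v x"
  define a where "a = x u - \<epsilon> * clip 1 (x v / m)"
  define b where "b = x v + m / \<epsilon> * a"
  have m: "level r v (T x) = m" by (simp add: level_forward m_def)
  have Tx: "T x = (scale_coordinates L c (exp (\<bar>x v\<bar> - \<bar>b\<bar>)) x)(u := a - \<epsilon> * q (b / m), v := b)"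
    by (simp add: shear_forward_def Let_def m_def a_def b_def)
  have co: "T x v = b" "T x u = a - \<epsilon> * q (b / m)" using uv by (auto simp: Tx)
  have 1: "T x u + \<epsilon> * q (b / m) = a" by (simp add: co)
  have 2: "b - m / \<epsilon> * a = x v" by (simp add: b_def)
  have 3: "a + \<epsilon> * clip 1 (x v / m) = x u" by (simp add: a_def)
  have "T' (T x) = (scale_coordinates L c (exp (\<bar>b\<bar> - \<bar>x v\<bar>)) (T x))(u := x u, v := x v)"
    by (simp only: shear_backward_def[of u v L c r \<epsilon> q "T x"] m Let_def 1 2 3 co(1))
  also have "\<dots> = x" unfolding Tx
    by (rule scale_moved_back) (auto simp: exp_add[symmetric])
  finally show ?thesis .
qed

lemma forward_backward: "T (T' y) = y"
proof -
  define m where "m = level r v y"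
  define a where "a = y u + \<epsilon> * q (y v / m)"
  define b where "b = y v - m / \<epsilon> * a"
  have m: "level r v (T' y) = m" by (simp add: level_backward m_def)
  have Ty: "T' y = (scale_coordinates L c (exp (\<bar>y v\<bar> - \<bar>b\<bar>)) y)(u := a + \<epsilon> * clip 1 (b / m), v := b)"
    by (simp add: shear_backward_def Let_def m_def a_def b_def)
  have co: "T' y v = b" "T' y u = a + \<epsilon> * clip 1 (b / m)" using uv by (auto simp: Ty)
  have 1: "T' y u - \<epsilon> * clip 1 (b / m) = a" by (simp add: co)
  have 2: "b + m / \<epsilon> * a = y v" by (simp add: b_def)
  have 3: "a - \<epsilon> * q (y v / m) = y u" by (simp add: a_def)
  have "T (T' y) = (scale_coordinates L c (exp (\<bar>b\<bar> - \<bar>y v\<bar>)) (T' y))(u := y u, v := y v)"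
    by (simp only: shear_forward_def[of u v L c r \<epsilon> q "T' y"] m Let_def 1 2 3 co(1))
  also have "\<dots> = y" unfolding Ty
    by (rule scale_moved_back) (auto simp: exp_add[symmetric])
  finally show ?thesis .
qed

lemma continuous_forward: "continuous_on UNIV T"
proof -
  note intros = continuous_intros continuous_on_level[OF r(1)] continuous_on_product_coordinates
    continuous_on_compose2[OF q] continuous_on_fun_upd continuous_on_id
  have "level r v x \<noteq> 0" for x using level_ge_1[of r v x] by linarith
  then show ?thesis using \<epsilon> unfolding shear_forward_def Let_def
    by (intro intros) auto
qed

lemma continuous_backward: "continuous_on UNIV T'"
proof -
  note intros = continuous_intros continuous_on_level[OF r(1)] continuous_on_product_coordinates
    continuous_on_compose2[OF q] continuous_on_fun_upd continuous_on_id
  have "level r v x \<noteq> 0" for x using level_ge_1[of r v x] by linarith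
  then show ?thesis using \<epsilon> unfolding shear_backward_def Let_def
    by (intro intros) auto
qed

text \<open>
  The term q only translates u. What remains is the function a \<mapsto> a + \<epsilon> clip (const - a / \<epsilon>), which is nondecreasing with slope
  at most 1, since the clipped term never decreases faster than a increases.
\<close>
lemma backward_lipschitz: "\<bar>T' (y(u := s)) u - T' (y(u := t)) u\<bar> \<le> \<bar>s - t\<bar>"
proof -
  define m where "m = level r v y"
  have m: "1 \<le> m" by (simp add: m_def level_ge_1)
  have lev: "level r v (y(u := s)) = m" for s
  proof -
    have "r (y(u := s)) = r y" using uv by (intro depends_onD[OF r(2)]) auto
    then show ?thesis using uv by (simp add: m_def level_def)
  qed
  define g where "g a = a + \<epsilon> * clip 1 ((y v - m / \<epsilon> * a) / m)" for a
  have val: "T' (y(u := s)) u = g (s + \<epsilon> * q (y v / m))" for s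
    using uv by (simp add: shear_backward_def Let_def lev g_def)
  have g: "\<bar>g b - g a\<bar> \<le> b - a" if "a \<le> b" for a b
  proof -
    have eq: "(y v - m / \<epsilon> * a) / m = y v / m - a / \<epsilon>" for a using m by (simp add: field_simps)
    have "y v / m - b / \<epsilon> \<le> y v / m - a / \<epsilon>" using that \<epsilon> by (simp add: divide_right_mono)
    from clip_slope[OF this, of 1]
    have "0 \<le> \<epsilon> * (clip 1 (y v / m - a / \<epsilon>) - clip 1 (y v / m - b / \<epsilon>))"
      "\<epsilon> * (clip 1 (y v / m - a / \<epsilon>) - clip 1 (y v / m - b / \<epsilon>)) \<le> \<epsilon> * (b / \<epsilon> - a / \<epsilon>)"
      using \<epsilon> by (auto intro!: mult_left_mono)
    moreover have "\<epsilon> * (b / \<epsilon> - a / \<epsilon>) = b - a" using \<epsilon> by (simp add: field_simps)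
    ultimately show ?thesis unfolding g_def eq by (simp add: abs_le_iff algebra_simps)
  qed
  show ?thesis
  proof (cases "s \<le> t")
    case True then show ?thesis using g[of "s + \<epsilon> * q (y v / m)" "t + \<epsilon> * q (y v / m)"] by (simp add: val)
  next
    case False then show ?thesis using g[of "t + \<epsilon> * q (y v / m)" "s + \<epsilon> * q (y v / m)"] by (simp add: val)
  qed
qed

lemma level_depends: "depends_on (level r v) (insert v R)"
  unfolding depends_on_def level_def
proof (intro allI impI)
  fix x y :: "'i \<Rightarrow> real" assume "\<forall>i\<in>insert v R. x i = y i"
  then have "r x = r y" "x v = y v" using depends_onD[OF r(2), of x y] by auto
  then show "ln (max (exp 1) (r x * exp \<bar>x v\<bar>)) = ln (max (exp 1) (r y * exp \<bar>y v\<bar>))" by simp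
qed

lemma depends_shear:
  assumes i: "i \<in> insert u (insert v R)"
  shows "depends_on (\<lambda>x. T x i) (insert u (insert v R))" "depends_on (\<lambda>x. T' x i) (insert u (insert v R))"
proof -
  have "T x i = T y i \<and> T' x i = T' y i" if xy: "\<forall>i\<in>insert u (insert v R). x i = y i" for x y
  proof -
    have "level r v x = level r v y" using xy by (intro depends_onD[OF level_depends]) auto
    moreover have "x u = y u" "x v = y v" "x i = y i" using xy i by blast+
    ultimately show ?thesis
      by (simp add: shear_forward_def shear_backward_def Let_def scale_coordinates_def)
  qed
  then show "depends_on (\<lambda>x. T x i) (insert u (insert v R))" "depends_on (\<lambda>x. T' x i) (insert u (insert v R))"
    unfolding depends_on_def by blast+
qed

lemma carry_step_shear: "carry_step u (insert v L) (insert v R) T T'"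
  unfolding carry_step_def
proof (intro conjI)
  show "\<forall>x i. i \<notin> insert u (insert v L) \<longrightarrow> T x i = x i"
    by (simp add: shear_forward_def Let_def scale_coordinates_def)
  have "insert u (insert v L) \<subseteq> insert u (insert v R)" using L by blast
  then show "\<forall>i\<in>insert u (insert v L). depends_on (\<lambda>x. T x i) (insert u (insert v R)) \<and>
      depends_on (\<lambda>x. T' x i) (insert u (insert v R))"
    using depends_shear by blast
  show "u \<notin> insert v R" "insert v L \<subseteq> insert v R" using uv L by auto
qed (simp_all add: continuous_forward continuous_backward backward_forward forward_backward backward_lipschitz)

text \<open>
  On X neither cut-off is active, so the quarter turn is exact and the new u is -\<epsilon> v / m.
\<close>
lemma forward_contracts:
  assumes "1 \<le> r x" and q_id: "q (x u / \<epsilon>) = x u / \<epsilon>"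
  shows "\<bar>T x u\<bar> \<le> \<epsilon>"
proof -
  define m where "m = level r v x"
  have m: "1 \<le> m" "\<bar>x v\<bar> \<le> m" using assms(1) by (auto simp: m_def level_ge_1 level_ge_abs)
  then have ab: "\<bar>x v / m\<bar> \<le> 1" by (simp add: abs_divide divide_le_eq)
  define a where "a = x u - \<epsilon> * clip 1 (x v / m)"
  have a: "a = x u - \<epsilon> * (x v / m)" using ab by (simp add: a_def clip_id)
  have "m / \<epsilon> * a = m * (x u / \<epsilon>) - x v" using m \<epsilon> by (simp add: a right_diff_distrib)
  then have b: "(x v + m / \<epsilon> * a) / m = x u / \<epsilon>" using m by simp
  have "T x u = a - \<epsilon> * q ((x v + m / \<epsilon> * a) / m)"
    using uv by (simp add: shear_forward_def Let_def m_def a_def)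
  also have "\<dots> = - (\<epsilon> * (x v / m))" unfolding b q_id using \<epsilon> by (simp add: a)
  finally have "\<bar>T x u\<bar> = \<bar>\<epsilon> * (x v / m)\<bar>" by simp
  also have "\<dots> = \<epsilon> * \<bar>x v / m\<bar>" using \<epsilon> by (simp only: abs_mult abs_of_pos)
  also have "\<dots> \<le> \<epsilon> * 1" using ab \<epsilon> by (intro mult_left_mono) auto
  finally show ?thesis by simp
qed

lemma backward_displacement:
  assumes "\<And>t. \<bar>q t\<bar> \<le> 2" shows "\<bar>T' y u - y u\<bar> \<le> 3 * \<epsilon>"
proof -
  obtain s t where "T' y u = y u + \<epsilon> * q s + \<epsilon> * clip 1 t"
    using uv by (simp add: shear_backward_def Let_def)
  then have "\<bar>T' y u - y u\<bar> = \<epsilon> * \<bar>q s + clip 1 t\<bar>" using \<epsilon> by (simp add: distrib_left[symmetric] abs_mult)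
  also have "\<bar>q s + clip 1 t\<bar> \<le> 3" using assms[of s] clip_bound[of 1 t] by linarith
  finally show ?thesis using \<epsilon> by (simp add: mult.commute)
qed

end

section \<open>Infinitely many steps\<close>

text \<open>
  The set R records where T and T' look. Blocks can be applied simultaneously as soon as
  these sets admit no cyclic dependence.
\<close>
definition supported_homeo :: "'i set \<Rightarrow> 'i set \<Rightarrow> (('i \<Rightarrow> real) \<Rightarrow> 'i \<Rightarrow> real) \<Rightarrow> (('i \<Rightarrow> real) \<Rightarrow> 'i \<Rightarrow> real) \<Rightarrow> bool"
  where "supported_homeo D R T T' \<longleftrightarrow>
    continuous_on UNIV T \<and> continuous_on UNIV T' \<and> (\<forall>x. T' (T x) = x) \<and> (\<forall>x. T (T' x) = x) \<and>
    D \<subseteq> R \<and> (\<forall>x i. i \<notin> D \<longrightarrow> T x i = x i) \<and>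
    (\<forall>i\<in>D. depends_on (\<lambda>x. T x i) R \<and> depends_on (\<lambda>x. T' x i) R)"

fun stage :: "(nat \<Rightarrow> 'a \<Rightarrow> 'a) \<Rightarrow> nat \<Rightarrow> 'a \<Rightarrow> 'a" where
  "stage T 0 x = x"
| "stage T (Suc n) x = T n (stage T n x)"

text \<open>
  The value of coordinate u before step n, computed backwards from a point y under the assumption that u has its final
  value y u already after k more steps. All other coordinates that the inverse steps look at
  are final at the time of use, so y can supply them.
\<close>
fun unwind :: "(nat \<Rightarrow> ('i \<Rightarrow> real) \<Rightarrow> 'i \<Rightarrow> real) \<Rightarrow> 'i \<Rightarrow> nat \<Rightarrow> nat \<Rightarrow> ('i \<Rightarrow> real) \<Rightarrow> real" where
  "unwind T' u n 0 y = y u"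
| "unwind T' u n (Suc k) y = T' n (y(u := unwind T' u (Suc n) k y)) u"

text \<open>
  The increment from f 0 to f 1 is left unbounded: the first step of a carry has to deal with an unbounded coordinate
  u and cannot move it by a bounded amount.
\<close>
lemma telescoping_limit:
  fixes f :: "nat \<Rightarrow> 'a::topological_space \<Rightarrow> real"
  assumes f: "\<And>n. continuous_on UNIV (f n)" and e: "summable e"
    and step: "\<And>n x. 0 < n \<Longrightarrow> \<bar>f (Suc n) x - f n x\<bar> \<le> e n"
  obtains g where "continuous_on UNIV g" "\<And>x. (\<lambda>n. f n x) \<longlonglongrightarrow> g x"
proof -
  define d where "d n x = f (Suc (Suc n)) x - f (Suc n) x" for n x
  have "uniform_limit UNIV (\<lambda>n x. \<Sum>i<n. d i x) (\<lambda>x. \<Sum>i. d i x) sequentially"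
    using step e by (intro Weierstrass_m_test[of UNIV d "\<lambda>n. e (Suc n)"]) (auto simp: d_def summable_Suc_iff)
  then have "uniform_limit UNIV (\<lambda>n x. f 1 x + (\<Sum>i<n. d i x)) (\<lambda>x. f 1 x + (\<Sum>i. d i x)) sequentially"
    by (intro uniform_limit_intros)
  moreover have "f 1 x + (\<Sum>i<n. d i x) = f (Suc n) x" for n x
    by (induction n) (auto simp: d_def)
  ultimately have lim: "uniform_limit UNIV (\<lambda>n. f (Suc n)) (\<lambda>x. f 1 x + (\<Sum>i. d i x)) sequentially"
    by simp
  then have "continuous_on UNIV (\<lambda>x. f 1 x + (\<Sum>i. d i x))"
    using f by (intro uniform_limit_theorem[OF _ lim]) auto
  moreover have "(\<lambda>n. f n x) \<longlonglongrightarrow> f 1 x + (\<Sum>i. d i x)" for x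
    using tendsto_uniform_limitI[OF lim, of x] by (subst filterlim_sequentially_Suc[symmetric]) simp
  ultimately show thesis using that by blast
qed

text \<open>
  Because of freshness, everything that step n looks at, apart from u, keeps its value after step n. Hence the inverse
  steps can be evaluated at the final point, up to the value of u.
\<close>
locale carry =
  fixes u :: 'i and D R :: "nat \<Rightarrow> 'i set" and T T' :: "nat \<Rightarrow> ('i \<Rightarrow> real) \<Rightarrow> 'i \<Rightarrow> real" and e :: "nat \<Rightarrow> real"
  assumes step: "\<And>n. carry_step u (D n) (R n) (T n) (T' n)"
    and fresh: "\<And>n k. n < k \<Longrightarrow> R n \<inter> D k = {}"
    and e: "summable e" and displacement: "\<And>n y. 0 < n \<Longrightarrow> \<bar>T' n y u - y u\<bar> \<le> e n"
begin

lemma cont: "continuous_on UNIV (T n)" "continuous_on UNIV (T' n)"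
  and inv [simp]: "T' n (T n x) = x" "T n (T' n x) = x"
  and uR: "u \<notin> R n" and DR: "D n \<subseteq> R n"
  and unchanged: "i \<noteq> u \<Longrightarrow> i \<notin> D n \<Longrightarrow> T n x i = x i"
  and dep: "i \<in> insert u (D n) \<Longrightarrow> depends_on (\<lambda>x. T n x i) (insert u (R n))"
    "i \<in> insert u (D n) \<Longrightarrow> depends_on (\<lambda>x. T' n x i) (insert u (R n))"
  and lipschitz: "\<bar>T' n (y(u := s)) u - T' n (y(u := t)) u\<bar> \<le> \<bar>s - t\<bar>"
  using step[of n] unfolding carry_step_def by auto

lemma unchanged': "i \<noteq> u \<Longrightarrow> i \<notin> D n \<Longrightarrow> T' n x i = x i"
  using unchanged[of i n "T' n x"] by simp

lemma uD: "u \<notin> D n" using uR DR by blast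

lemma disjoint: "i \<in> D n \<Longrightarrow> i \<in> D k \<Longrightarrow> n = k"
  using fresh[of n k] fresh[of k n] DR by (metis disjoint_iff linorder_neqE_nat subsetD)

lemma continuous_stage: "continuous_on UNIV (stage T n)"
proof (induction n)
  case (Suc n)
  have "continuous_on UNIV (\<lambda>x. T n (stage T n x))" by (intro continuous_on_compose2[OF cont(1) Suc]) auto
  then show ?case by simp
qed (simp add: continuous_on_id)

lemma stage_increment: "0 < n \<Longrightarrow> \<bar>stage T (Suc n) x u - stage T n x u\<bar> \<le> e n"
  using displacement[of n "T n (stage T n x)"] by (simp add: abs_minus_commute)

lemma stage_unchanged:
  assumes "m \<le> n" "i \<noteq> u" "\<And>k. m \<le> k \<Longrightarrow> k < n \<Longrightarrow> i \<notin> D k"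
  shows "stage T n x i = stage T m x i"
  using assms by (induction n rule: dec_induct) (auto simp: unchanged)

lemma continuous_back: "continuous_on UNIV (unwind T' u n k)"
proof (induction k arbitrary: n)
  case 0 then show ?case by (simp add: continuous_on_product_coordinates)
next
  case (Suc k)
  have "continuous_on UNIV (\<lambda>y. T' n (y(u := unwind T' u (Suc n) k y)))"
    by (intro continuous_on_compose2[OF cont(2)] continuous_on_fun_upd Suc continuous_on_id) auto
  then have "continuous_on UNIV (\<lambda>y. T' n (y(u := unwind T' u (Suc n) k y)) u)"
    by (rule continuous_on_product_then_coordinatewise)
  then show ?case by simp
qed

lemma back_increment: "0 < n + k \<Longrightarrow> \<bar>unwind T' u n (Suc k) y - unwind T' u n k y\<bar> \<le> e (n + k)"
proof (induction k arbitrary: n)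
  case 0 then show ?case using displacement[of n y] by simp
next
  case (Suc k)
  have "\<bar>unwind T' u n (Suc (Suc k)) y - unwind T' u n (Suc k) y\<bar>
      \<le> \<bar>unwind T' u (Suc n) (Suc k) y - unwind T' u (Suc n) k y\<bar>"
    unfolding unwind.simps(2)[of _ _ n] by (rule lipschitz)
  also have "\<dots> \<le> e (Suc n + k)" by (rule Suc.IH) simp
  finally show ?case by simp
qed

text \<open>
  Since the inverse steps are nonexpanding in u, an error in the final value is never amplified by unwinding, and the
  displacements are summable; so the values computed backwards converge uniformly. The
  recursion for W n follows by passing to the limit, and W n approaches the final value y u.
\<close>
lemma limit_value:
  obtains W where "\<And>n. continuous_on UNIV (W n)" "\<And>n y. (\<lambda>k. unwind T' u n k y) \<longlonglongrightarrow> W n y"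
    "\<And>n y. W n y = T' n (y(u := W (Suc n) y)) u" "\<And>y. (\<lambda>n. W n y) \<longlonglongrightarrow> y u"
proof -
  have "\<exists>g. continuous_on UNIV g \<and> (\<forall>y. (\<lambda>k. unwind T' u n k y) \<longlonglongrightarrow> g y)" for n
  proof -
    have "summable (\<lambda>k. e (n + k))" using e by (simp add: summable_iff_shift add.commute)
    then show ?thesis
      using telescoping_limit[of "unwind T' u n" "\<lambda>k. e (n + k)"] continuous_back back_increment
      by (metis add_gr_0)
  qed
  then obtain W where W: "\<And>n. continuous_on UNIV (W n)" "\<And>n y. (\<lambda>k. unwind T' u n k y) \<longlonglongrightarrow> W n y"
    by metis
  have rec: "W n y = T' n (y(u := W (Suc n) y)) u" for n y
  proof (rule LIMSEQ_unique)
    show "(\<lambda>k. unwind T' u n (Suc k) y) \<longlonglongrightarrow> W n y" using W(2) by (rule LIMSEQ_Suc)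
    have "(\<lambda>k. \<bar>unwind T' u (Suc n) k y - W (Suc n) y\<bar>) \<longlonglongrightarrow> 0"
      using W(2)[where n = "Suc n" and y = y] by (simp add: LIM_zero_iff tendsto_rabs_zero_iff)
    then have "(\<lambda>k. unwind T' u n (Suc k) y - T' n (y(u := W (Suc n) y)) u) \<longlonglongrightarrow> 0"
      by (rule tendsto_0_le[where K = 1]) (use lipschitz in auto)
    then show "(\<lambda>k. unwind T' u n (Suc k) y) \<longlonglongrightarrow> T' n (y(u := W (Suc n) y)) u"
      by (simp only: LIM_zero_iff)
  qed
  have "(\<lambda>n. W n y - y u) \<longlonglongrightarrow> 0" for y
  proof (rule Lim_null_comparison)
    have bound: "\<bar>unwind T' u n k y - y u\<bar> \<le> (\<Sum>j<k. e (n + j))" if "0 < n" for n k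
    proof (induction k)
      case (Suc k)
      have "\<bar>unwind T' u n (Suc k) y - unwind T' u n k y\<bar> \<le> e (n + k)"
        using that by (intro back_increment) simp
      then show ?case using Suc unfolding sum.lessThan_Suc by linarith
    qed simp
    have epos: "0 \<le> e n" if "0 < n" for n using displacement[OF that, of "\<lambda>_. 0"] by linarith
    have sm: "summable (\<lambda>j. e (n + j))" for n using e by (simp add: summable_iff_shift add.commute)
    have "\<bar>W n y - y u\<bar> \<le> (\<Sum>j. e (n + j))" if n: "0 < n" for n
    proof (rule LIMSEQ_le_const2)
      show "(\<lambda>k. \<bar>unwind T' u n k y - y u\<bar>) \<longlonglongrightarrow> \<bar>W n y - y u\<bar>" by (intro tendsto_intros W)
      have "(\<Sum>j<k. e (n + j)) \<le> (\<Sum>j. e (n + j))" for k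
        using n epos by (intro sum_le_suminf sm) auto
      then show "\<exists>N. \<forall>k\<ge>N. \<bar>unwind T' u n k y - y u\<bar> \<le> (\<Sum>j. e (n + j))"
        using bound[OF n] order_trans by blast
    qed
    then show "\<forall>\<^sub>F n in sequentially. norm (W n y - y u) \<le> (\<Sum>j. e (j + n))"
      by (intro eventually_sequentiallyI[of 1]) (auto simp: add.commute)
    have "(\<lambda>n. suminf e - (\<Sum>j<n. e j)) \<longlonglongrightarrow> suminf e - suminf e"
      by (intro tendsto_intros summable_LIMSEQ e)
    then show "(\<lambda>n. \<Sum>j. e (j + n)) \<longlonglongrightarrow> 0"
      by (simp add: suminf_minus_initial_segment[OF e])
  qed
  then have "(\<lambda>n. W n y) \<longlonglongrightarrow> y u" for y by (simp add: LIM_zero_iff)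
  then show thesis using that W rec by blast
qed

text \<open>
  A coordinate in D n moves in step n only, and u converges uniformly; this defines the limit \<Phi>. Its
  inverse \<Psi> first determines all the intermediate values W n of u and then applies each inverse step with
  the right value of u.
\<close>
lemma carry_limit:
  obtains \<Phi> \<Psi> where "supported_homeo (insert u (\<Union>n. D n)) (insert u (\<Union>n. R n)) \<Phi> \<Psi>"
    "\<And>x. (\<lambda>n. stage T n x u) \<longlonglongrightarrow> \<Phi> x u"
proof -
  obtain U where U: "continuous_on UNIV U" "\<And>x. (\<lambda>n. stage T n x u) \<longlonglongrightarrow> U x"
    using telescoping_limit[of "\<lambda>n x. stage T n x u" e,
        OF continuous_on_product_then_coordinatewise[OF continuous_stage] e stage_increment]
    by blast
  obtain W where W: "\<And>n. continuous_on UNIV (W n)" "\<And>n y. (\<lambda>k. unwind T' u n k y) \<longlonglongrightarrow> W n y"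
    "\<And>n y. W n y = T' n (y(u := W (Suc n) y)) u" "\<And>y. (\<lambda>n. W n y) \<longlonglongrightarrow> y u"
    by (rule limit_value, rule that, assumption+)
  define idx where "idx i = (THE n. i \<in> D n)" for i
  have idx: "idx i = n" if "i \<in> D n" for i n
    unfolding idx_def by (rule the_equality, rule that) (rule disjoint[OF _ that])
  define \<Phi> where "\<Phi> x i = (if i = u then U x else if \<exists>n. i \<in> D n then stage T (Suc (idx i)) x i else x i)" for x i
  define \<Psi> where "\<Psi> y i = (if i = u then W 0 y else if \<exists>n. i \<in> D n then T' (idx i) (y(u := W (Suc (idx i)) y)) i else y i)" for y i
  have \<Phi>D: "\<Phi> x i = stage T (Suc n) x i" if "i \<in> D n" for x i n
  proof -
    have "i \<noteq> u" "\<exists>n. i \<in> D n" using that uD by blast+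
    then show ?thesis by (simp only: \<Phi>_def idx[OF that] if_False if_True)
  qed
  have \<Psi>D: "\<Psi> y i = T' n (y(u := W (Suc n) y)) i" if "i \<in> D n" for y i n
  proof -
    have "i \<noteq> u" "\<exists>n. i \<in> D n" using that uD by blast+
    then show ?thesis by (simp only: \<Psi>_def idx[OF that] if_False if_True)
  qed
  have \<Phi>u: "\<Phi> x u = U x" and \<Psi>u: "\<Psi> y u = W 0 y" for x y by (auto simp: \<Phi>_def \<Psi>_def)
  have \<Phi>N: "\<Phi> x i = x i" and \<Psi>N: "\<Psi> y i = y i" if "i \<noteq> u" "\<And>n. i \<notin> D n" for x y i
    using that by (auto simp: \<Phi>_def \<Psi>_def)
  have left_inverse: "\<Psi> (\<Phi> x) = x" for x
  proof -
    define y where "y = \<Phi> x"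
    have agree: "y i = stage T (Suc n) x i" if "i \<in> R n" for n i
    proof -
      have iu: "i \<noteq> u" using that uR by blast
      show ?thesis
      proof (cases "\<exists>m. i \<in> D m")
        case True
        then obtain m where m: "i \<in> D m" by blast
        have mn: "m \<le> n" using fresh[of n m] that m by (meson disjoint_iff not_le)
        have "i \<notin> D k" if "k \<noteq> m" for k using m disjoint that by blast
        then have "stage T (Suc n) x i = stage T (Suc m) x i"
          using mn by (intro stage_unchanged iu) simp_all
        then show ?thesis using m by (simp only: y_def \<Phi>D)
      next
        case False
        then have "stage T (Suc n) x i = stage T 0 x i" using iu by (intro stage_unchanged) auto
        then show ?thesis using False iu by (simp add: y_def \<Phi>N)
      qed
    qed
    have undo: "T' n (y(u := stage T (Suc n) x u)) i = stage T n x i" if "i \<in> insert u (D n)" for n i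
    proof -
      have "T' n (y(u := stage T (Suc n) x u)) i = T' n (stage T (Suc n) x) i"
        using agree by (intro depends_onD[OF dep(2)[OF that]]) auto
      then show ?thesis by simp
    qed
    have bound: "\<bar>unwind T' u n k y - stage T n x u\<bar> \<le> \<bar>y u - stage T (n + k) x u\<bar>" for n k
    proof (induction k arbitrary: n)
      case (Suc k)
      have "\<bar>unwind T' u n (Suc k) y - stage T n x u\<bar>
          = \<bar>T' n (y(u := unwind T' u (Suc n) k y)) u - T' n (y(u := stage T (Suc n) x u)) u\<bar>"
        unfolding undo[OF insertI1] unwind.simps ..
      also have "\<dots> \<le> \<bar>unwind T' u (Suc n) k y - stage T (Suc n) x u\<bar>" by (rule lipschitz)
      also have "\<dots> \<le> \<bar>y u - stage T (Suc n + k) x u\<bar>" by (rule Suc.IH)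
      finally show ?case by simp
    qed simp
    have vanish: "(\<lambda>k. \<bar>y u - stage T (n + k) x u\<bar>) \<longlonglongrightarrow> 0" for n
    proof -
      have "(\<lambda>k. stage T (k + n) x u) \<longlonglongrightarrow> U x" using U(2) by (rule LIMSEQ_ignore_initial_segment)
      then have "(\<lambda>k. \<bar>y u - stage T (k + n) x u\<bar>) \<longlonglongrightarrow> \<bar>y u - U x\<bar>" by (intro tendsto_intros)
      moreover have "y u - U x = 0" by (simp add: y_def \<Phi>u)
      ultimately show ?thesis by (simp only: add.commute[of n] abs_zero)
    qed
    have "(\<lambda>k. unwind T' u n k y - stage T n x u) \<longlonglongrightarrow> 0" for n
      by (rule Lim_null_comparison[OF always_eventually vanish[of n]]) (simp only: real_norm_def bound simp_thms)
    then have "(\<lambda>k. unwind T' u n k y) \<longlonglongrightarrow> stage T n x u" for n by (simp only: LIM_zero_iff)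
    then have Wy: "W n y = stage T n x u" for n using W(2) LIMSEQ_unique by blast
    show ?thesis
    proof
      fix i
      show "\<Psi> (\<Phi> x) i = x i"
      proof (cases "i = u")
        case True then show ?thesis using Wy[of 0] by (simp add: \<Psi>u y_def)
      next
        case iu: False
        show ?thesis
        proof (cases "\<exists>m. i \<in> D m")
          case True
          then obtain m where m: "i \<in> D m" by blast
          have "\<Psi> y i = T' m (y(u := stage T (Suc m) x u)) i" unfolding \<Psi>D[OF m] Wy ..
          also have "\<dots> = stage T m x i" by (rule undo) (use m in blast)
          also have "\<dots> = stage T 0 x i"
          proof (intro stage_unchanged iu)
            fix k assume "k < m"
            then show "i \<notin> D k" using m disjoint by blast
          qed simp
          finally show ?thesis by (simp add: y_def)
        next
          case False
          then show ?thesis using iu by (simp add: \<Psi>N \<Phi>N)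
        qed
      qed
    qed
  qed
  have right_inverse: "\<Phi> (\<Psi> y) = y" for y
  proof -
    define x where "x = \<Psi> y"
    \<comment> \<open>The point that the first n steps should produce from \<open>\<Psi> y\<close>: u has its intermediate value, and
      the coordinates of those steps are final.\<close>
    define Y where "Y n i = (if i = u then W n y else if \<exists>k<n. i \<in> D k then y i else x i)" for n i
    have back1: "T' n (Y (Suc n)) = Y n" for n
    proof
      fix i
      show "T' n (Y (Suc n)) i = Y n i"
      proof (cases "i \<in> insert u (D n)")
        case False
        then have "(\<exists>k<Suc n. i \<in> D k) \<longleftrightarrow> (\<exists>k<n. i \<in> D k)" by (auto simp: less_Suc_eq)
        then show ?thesis using False by (simp add: unchanged' Y_def)
      next
        case True
        have "T' n (Y (Suc n)) i = T' n (y(u := W (Suc n) y)) i"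
        proof (rule depends_onD[OF dep(2)[OF True]])
          fix j assume j: "j \<in> insert u (R n)"
          show "Y (Suc n) j = (y(u := W (Suc n) y)) j"
          proof (cases "j = u \<or> (\<exists>k<Suc n. j \<in> D k)")
            case True then show ?thesis using uD by (auto simp: Y_def)
          next
            case False
            then have "j \<notin> D k" for k using j fresh[of n k] by (cases "k < Suc n") auto
            then show ?thesis using False by (simp add: Y_def x_def \<Psi>N)
          qed
        qed
        also have "\<dots> = Y n i"
        proof (cases "i = u")
          case True then show ?thesis using W(3)[of n y] by (simp add: Y_def)
        next
          case False
          then have i: "i \<in> D n" using True by simp
          then have none: "(\<exists>k<n. i \<in> D k) = False" using disjoint by blast
          have "Y n i = \<Psi> y i" using False by (simp only: Y_def none if_False x_def)
          then show ?thesis unfolding \<Psi>D[OF i] ..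
        qed
        finally show ?thesis .
      qed
    qed
    have st: "stage T n x = Y n" for n
    proof (induction n)
      case 0 then show ?case by (auto simp: Y_def x_def \<Psi>u)
    next
      case (Suc n)
      have "stage T (Suc n) x = T n (T' n (Y (Suc n)))" by (simp only: stage.simps Suc back1)
      then show ?case by simp
    qed
    show ?thesis
    proof
      fix i
      show "\<Phi> (\<Psi> y) i = y i"
      proof (cases "i = u")
        case True
        have "(\<lambda>n. stage T n x u) \<longlonglongrightarrow> y u" using W(4)[of y] by (simp add: st Y_def)
        then have "U x = y u" using U(2) LIMSEQ_unique by blast
        then show ?thesis using True by (simp add: \<Phi>u x_def)
      next
        case iu: False
        show ?thesis
        proof (cases "\<exists>m. i \<in> D m")
          case True
          then obtain m where m: "i \<in> D m" by blast
          then have "\<Phi> x i = Y (Suc m) i" by (simp only: \<Phi>D st)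
          also have "\<dots> = y i" using m iu by (auto simp: Y_def)
          finally show ?thesis by (simp add: x_def)
        next
          case False
          then show ?thesis using iu by (simp add: \<Psi>N \<Phi>N)
        qed
      qed
    qed
  qed
  have cont_\<Phi>: "continuous_on UNIV \<Phi>"
  proof (rule continuous_on_coordinatewise_then_product)
    fix i
    show "continuous_on UNIV (\<lambda>x. \<Phi> x i)"
      using U(1) continuous_on_product_then_coordinatewise[OF continuous_stage, of _ i]
      unfolding \<Phi>_def
      by (cases "i = u"; cases "\<exists>n. i \<in> D n") (simp_all add: continuous_on_product_coordinates del: stage.simps)
  qed
  have cont_\<Psi>: "continuous_on UNIV \<Psi>"
  proof (rule continuous_on_coordinatewise_then_product)
    fix i
    have "continuous_on UNIV (\<lambda>y. T' n (y(u := W (Suc n) y)))" for n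
      by (intro continuous_on_compose2[OF cont(2)] continuous_on_fun_upd W continuous_on_id) auto
    from continuous_on_product_then_coordinatewise[OF this, of _ i]
    show "continuous_on UNIV (\<lambda>x. \<Psi> x i)"
      using W(1)[of 0] unfolding \<Psi>_def
      by (cases "i = u"; cases "\<exists>n. i \<in> D n") (simp_all add: continuous_on_product_coordinates)
  qed
  have depends: "depends_on (\<lambda>x. \<Phi> x i) (insert u (\<Union>n. R n)) \<and> depends_on (\<lambda>x. \<Psi> x i) (insert u (\<Union>n. R n))"
    if i: "i \<in> insert u (\<Union>n. D n)" for i
  proof -
    let ?S = "insert u (\<Union>n. R n)"
    have "\<Phi> x i = \<Phi> y i \<and> \<Psi> x i = \<Psi> y i" if xy: "\<forall>j\<in>?S. x j = y j" for x y
    proof -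
      have st: "stage T n x j = stage T n y j" if "j \<in> ?S" for n j
        using that
      proof (induction n arbitrary: j)
        case 0 then show ?case using xy by (metis stage.simps(1))
      next
        case (Suc n)
        show ?case
        proof (cases "j \<in> insert u (D n)")
          case True
          have "T n (stage T n x) j = T n (stage T n y) j"
            by (rule depends_onD[OF dep(1)[OF True]]) (rule Suc.IH, auto)
          then show ?thesis by simp
        next
          case False
          then show ?thesis using Suc by (simp add: unchanged)
        qed
      qed
      have bk: "unwind T' u n k x = unwind T' u n k y" for n k
      proof (induction k arbitrary: n)
        case 0 then show ?case using xy by simp
      next
        case (Suc k)
        have "T' n (x(u := unwind T' u (Suc n) k x)) u = T' n (y(u := unwind T' u (Suc n) k y)) u"
          using xy Suc by (intro depends_onD[OF dep(2)[of u n]]) auto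
        then show ?case by simp
      qed
      have WW: "W n x = W n y" for n
        using W(2)[of n x] W(2)[of n y] unfolding bk[of n] by (rule LIMSEQ_unique)
      have UU: "U x = U y"
        using U(2)[of x] U(2)[of y] unfolding st[OF insertI1] by (rule LIMSEQ_unique)
      show ?thesis
      proof (cases "i = u")
        case True then show ?thesis using WW UU by (simp add: \<Phi>u \<Psi>u)
      next
        case False
        then obtain n where n: "i \<in> D n" using i by auto
        then have "i \<in> ?S" using DR by blast
        then have "\<Phi> x i = \<Phi> y i" unfolding \<Phi>D[OF n] by (rule st)
        moreover have "T' n (x(u := W (Suc n) x)) i = T' n (y(u := W (Suc n) y)) i"
        proof (rule depends_onD[OF dep(2)])
          show "i \<in> insert u (D n)" using n by blast
          fix j assume "j \<in> insert u (R n)"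
          then have "x j = y j" using xy by blast
          then show "(x(u := W (Suc n) x)) j = (y(u := W (Suc n) y)) j" by (simp add: WW)
        qed
        ultimately show ?thesis unfolding \<Psi>D[OF n] by (rule conjI)
      qed
    qed
    then show ?thesis unfolding depends_on_def by blast
  qed
  have outside: "\<Phi> x i = x i" if "i \<notin> insert u (\<Union>n. D n)" for x i
    using that by (intro \<Phi>N) auto
  have homeo: "supported_homeo (insert u (\<Union>n. D n)) (insert u (\<Union>n. R n)) \<Phi> \<Psi>"
    unfolding supported_homeo_def
  proof (intro conjI)
    show "insert u (\<Union>n. D n) \<subseteq> insert u (\<Union>n. R n)" using DR by blast
  qed (use left_inverse right_inverse cont_\<Phi> cont_\<Psi> depends outside in simp_all)
  show thesis
  proof (rule that[OF homeo])
    fix x show "(\<lambda>n. stage T n x u) \<longlonglongrightarrow> \<Phi> x u" unfolding \<Phi>u by (rule U(2))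
  qed
qed

end

section \<open>Flattening countably many coordinates\<close>

lemma Lindelof_homeo_image:
  assumes "Lindelof_space (top_of_set X)" "continuous_on X T"
  shows "Lindelof_space (top_of_set (T ` X))"
  using Lindelof_space_continuous_map_image[OF assms(1), of "top_of_set (T ` X)" T] assms(2) by auto

lemma separated_homeo_image:
  fixes T T' :: "'a::topological_space \<Rightarrow> 'a"
  assumes X: "separated_from_zero_sets X" and T: "continuous_on UNIV T" "continuous_on UNIV T'" "\<And>x. T' (T x) = x"
  shows "separated_from_zero_sets (T ` X)"
  unfolding separated_from_zero_sets_def
proof (intro allI impI)
  fix w :: "'a \<Rightarrow> real" assume w: "continuous_on UNIV w" "\<forall>x\<in>T ` X. 0 < w x"
  have "continuous_on UNIV (\<lambda>x. w (T x))" by (intro continuous_on_compose2[OF w(1) T(1)]) auto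
  then obtain H where H: "continuous_on UNIV H" "\<forall>x\<in>X. 1 \<le> H x * w (T x)"
    using X w(2) unfolding separated_from_zero_sets_def by blast
  have "continuous_on UNIV (\<lambda>x. H (T' x))" by (intro continuous_on_compose2[OF H(1) T(2)]) auto
  then show "\<exists>H. continuous_on UNIV H \<and> (\<forall>x\<in>T ` X. 1 \<le> H x * w x)"
    using H(2) T(3) by (intro exI[of _ "\<lambda>x. H (T' x)"]) auto
qed

lemma uncountable_avoids_countable:
  assumes "uncountable P" "countable R" obtains x where "x \<in> P" "x \<notin> R"
proof -
  have "\<not> P \<subseteq> R" using assms countable_subset by blast
  then show thesis using that by blast
qed

text \<open>
  Here u is unbounded on X, so the last shear is not cut off. The coordinate u is chosen after the gauge, among
  the coordinates on which the gauge does not depend.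
\<close>
lemma first_carry_step:
  fixes X :: "('i \<Rightarrow> real) set"
  assumes X: "Lindelof_space (top_of_set X)" "separated_from_zero_sets X" and P: "uncountable P"
  obtains u D R T T' where "u \<in> P" "D \<subseteq> P" "D \<noteq> {}" "countable R" "carry_step u D R T T'"
    "\<And>x. x \<in> X \<Longrightarrow> \<bar>T x u\<bar> \<le> 1"
proof -
  obtain L c r R where g: "L \<subseteq> P" "countable R" "L \<subseteq> R" "continuous_on UNIV r" "depends_on r R"
    "\<And>x. 0 \<le> r x" "\<And>x t. 0 < t \<Longrightarrow> r (scale_coordinates L c t x) = t * r x" "\<And>x. x \<in> X \<Longrightarrow> 1 \<le> r x"
    by (rule gauge_exists[OF X P], rule that, assumption+)
  obtain u where u: "u \<in> P" "u \<notin> R" using uncountable_avoids_countable[OF P g(2)] .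
  have "countable (insert u R)" using g(2) by simp
  then obtain v where v: "v \<in> P" "v \<notin> insert u R" using uncountable_avoids_countable[OF P] by blast
  interpret shear u v L c r R 1 "\<lambda>t. t"
    by unfold_locales (use u v g in auto)
  show thesis
  proof (rule that[OF _ _ _ _ carry_step_shear])
    show "\<bar>T x u\<bar> \<le> 1" if "x \<in> X" for x by (rule forward_contracts) (use g(8) that in auto)
  qed (use u v g in auto)
qed

text \<open>
  With \<bar>u\<bar> \<le> 2 \<epsilon> the quotient u / \<epsilon> is at most 2 on X, so cutting off at 2 has no effect there, but bounds
  the displacement everywhere.
\<close>
lemma next_carry_step:
  fixes X :: "('i \<Rightarrow> real) set"
  assumes X: "Lindelof_space (top_of_set X)" "separated_from_zero_sets X" and P: "uncountable P" "u \<notin> P"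
    and \<epsilon>: "0 < \<epsilon>" and bound: "\<And>x. x \<in> X \<Longrightarrow> \<bar>x u\<bar> \<le> 2 * \<epsilon>"
  obtains D R T T' where "D \<subseteq> P" "countable R" "carry_step u D R T T'"
    "\<And>x. x \<in> X \<Longrightarrow> \<bar>T x u\<bar> \<le> \<epsilon>" "\<And>y. \<bar>T' y u - y u\<bar> \<le> 3 * \<epsilon>"
proof -
  have "0 \<le> 2 * \<epsilon>" using \<epsilon> by simp
  obtain L c r R where g: "L \<subseteq> P" "countable R" "L \<subseteq> R" "u \<notin> R" "continuous_on UNIV r" "depends_on r R"
    "\<And>x. 0 \<le> r x" "\<And>x t. 0 < t \<Longrightarrow> r (scale_coordinates L c t x) = t * r x" "\<And>x. x \<in> X \<Longrightarrow> 1 \<le> r x"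
    using gauge_exists_bounded_coordinate[OF X P _ \<open>0 \<le> 2 * \<epsilon>\<close>] bound by metis
  obtain v where v: "v \<in> P" "v \<notin> R" using uncountable_avoids_countable[OF P(1) g(2)] .
  interpret shear u v L c r R \<epsilon> "clip 2"
    by unfold_locales (use v g P \<epsilon> continuous_on_clip[OF continuous_on_id] in auto)
  show thesis
  proof (rule that[OF _ _ carry_step_shear])
    show "\<bar>T x u\<bar> \<le> \<epsilon>" if "x \<in> X" for x
    proof (rule forward_contracts)
      have "\<bar>x u / \<epsilon>\<bar> \<le> 2" using bound[OF that] \<epsilon> by (simp add: abs_divide divide_le_eq)
      then show "clip 2 (x u / \<epsilon>) = x u / \<epsilon>" by (rule clip_id)
    qed (use g(9) that in auto)
    show "\<bar>T' y u - y u\<bar> \<le> 3 * \<epsilon>" for y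
      by (rule backward_displacement) (simp add: clip_bound)
  qed (use v g in auto)
qed

text \<open>
  Each step works with the image Y of X under the earlier steps and takes its new coordinates outside
  the set Z of all coordinates at which the earlier steps look. The coordinate v, another one
  in D, guarantees that many coordinates remain besides those that are made to vanish.
\<close>
lemma flattening_block:
  fixes X :: "('i \<Rightarrow> real) set"
  assumes X: "Lindelof_space (top_of_set X)" "separated_from_zero_sets X" and P: "uncountable P"
  obtains u v D R \<Phi> \<Psi> where "supported_homeo D R \<Phi> \<Psi>" "D \<subseteq> P" "countable R" "u \<in> D" "v \<in> D" "v \<noteq> u"
    "\<And>x. x \<in> X \<Longrightarrow> \<Phi> x u = 0"
proof -
  obtain u D0 R0 T0 T0' where first: "u \<in> P" "D0 \<subseteq> P" "D0 \<noteq> {}" "countable R0" "carry_step u D0 R0 T0 T0'"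
    "\<And>x. x \<in> X \<Longrightarrow> \<bar>T0 x u\<bar> \<le> 1"
    using first_carry_step[OF X P] by blast
  define good where "good n s = (case s of (D, R, T, T', Y, Z) \<Rightarrow> carry_step u D R T T' \<and> countable R \<and> countable Z \<and>
      Lindelof_space (top_of_set Y) \<and> separated_from_zero_sets Y \<and> D \<subseteq> P - Z \<and>
      (\<forall>x\<in>Y. \<bar>T x u\<bar> \<le> (1/2)^n) \<and> (0 < n \<longrightarrow> (\<forall>y. \<bar>T' y u - y u\<bar> \<le> 3 * (1/2)^n)) \<and>
      (n = 0 \<longrightarrow> Y = X \<and> D \<noteq> {}))"
    for n :: nat and s :: "'i set \<times> 'i set \<times> (('i \<Rightarrow> real) \<Rightarrow> 'i \<Rightarrow> real) \<times> (('i \<Rightarrow> real) \<Rightarrow> 'i \<Rightarrow> real) \<times> ('i \<Rightarrow> real) set \<times> 'i set"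
  define follows where "follows s t = (case s of (D, R, T, T', Y, Z) \<Rightarrow> case t of (D2, R2, T2, T2', Y2, Z2) \<Rightarrow> Y2 = T ` Y \<and> Z2 = Z \<union> R)"
    for s t :: "'i set \<times> 'i set \<times> (('i \<Rightarrow> real) \<Rightarrow> 'i \<Rightarrow> real) \<times> (('i \<Rightarrow> real) \<Rightarrow> 'i \<Rightarrow> real) \<times> ('i \<Rightarrow> real) set \<times> 'i set"
  have "\<exists>f. \<forall>n. good n (f n) \<and> follows (f n) (f (Suc n))"
  proof (rule dependent_nat_choice)
    show "\<exists>s. good 0 s"
      using first X by (intro exI[of _ "(D0, R0, T0, T0', X, {})"]) (simp add: good_def)
  next
    fix s n assume s: "good n s"
    obtain D R T T' Y Z where seq: "s = (D, R, T, T', Y, Z)" by (metis prod_cases6)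
    have g: "carry_step u D R T T'" "countable R" "countable Z" "Lindelof_space (top_of_set Y)"
        "separated_from_zero_sets Y" "\<forall>x\<in>Y. \<bar>T x u\<bar> \<le> (1/2)^n"
      using s by (auto simp: good_def seq)
    have T: "continuous_on UNIV T" "continuous_on UNIV T'" "\<And>x. T' (T x) = x"
      using g(1) by (auto simp: carry_step_def)
    have Y: "Lindelof_space (top_of_set (T ` Y))" "separated_from_zero_sets (T ` Y)"
      using Lindelof_homeo_image[OF g(4) continuous_on_subset[OF T(1)]] separated_homeo_image[OF g(5) T] by auto
    have Q: "uncountable (P - (Z \<union> R) - {u})" "u \<notin> P - (Z \<union> R) - {u}"
      using P g(2,3) by (auto simp: uncountable_minus_countable)
    have bd: "\<bar>x u\<bar> \<le> 2 * (1/2)^Suc n" if "x \<in> T ` Y" for x using that g(6) by auto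
    obtain D2 R2 T2 T2' where n: "D2 \<subseteq> P - (Z \<union> R) - {u}" "countable R2" "carry_step u D2 R2 T2 T2'"
      "\<And>x. x \<in> T ` Y \<Longrightarrow> \<bar>T2 x u\<bar> \<le> (1/2)^Suc n" "\<And>y. \<bar>T2' y u - y u\<bar> \<le> 3 * (1/2)^Suc n"
    proof (rule next_carry_step[OF Y Q])
      show "(0::real) < (1/2)^Suc n" by simp
      show "\<And>x. x \<in> T ` Y \<Longrightarrow> \<bar>x u\<bar> \<le> 2 * (1/2)^Suc n" by (rule bd)
    qed (rule that, assumption+)
    show "\<exists>t. good (Suc n) t \<and> follows s t"
    proof (intro exI conjI)
      show "good (Suc n) (D2, R2, T2, T2', T ` Y, Z \<union> R)"
        unfolding good_def prod.case using n Y g(2,3) by (auto simp del: power_Suc)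
      show "follows s (D2, R2, T2, T2', T ` Y, Z \<union> R)" by (simp add: follows_def seq)
    qed
  qed
  then obtain f where f: "\<And>n. good n (f n)" "\<And>n. follows (f n) (f (Suc n))" by blast
  define D where "D n = fst (f n)" for n
  define R where "R n = fst (snd (f n))" for n
  define T where "T n = fst (snd (snd (f n)))" for n
  define T' where "T' n = fst (snd (snd (snd (f n))))" for n
  define Y where "Y n = fst (snd (snd (snd (snd (f n)))))" for n
  define Z where "Z n = snd (snd (snd (snd (snd (f n)))))" for n
  have feq: "f n = (D n, R n, T n, T' n, Y n, Z n)" for n
    by (simp add: D_def R_def T_def T'_def Y_def Z_def)
  have g: "carry_step u (D n) (R n) (T n) (T' n)" "countable (R n)" "D n \<subseteq> P - Z n"
      "\<And>x. x \<in> Y n \<Longrightarrow> \<bar>T n x u\<bar> \<le> (1/2)^n" "\<And>y. 0 < n \<Longrightarrow> \<bar>T' n y u - y u\<bar> \<le> 3 * (1/2)^n" for n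
    using f(1)[of n] unfolding feq good_def prod.case by blast+
  have start: "Y 0 = X" "D 0 \<noteq> {}"
    using f(1)[of 0] unfolding feq good_def prod.case by blast+
  have succ: "Y (Suc n) = T n ` Y n" "Z (Suc n) = Z n \<union> R n" for n
    using f(2)[of n] unfolding feq follows_def prod.case by blast+
  have Zmono: "R n \<subseteq> Z k" if "n < k" for n k
    using that by (induction k) (auto simp: succ less_Suc_eq)
  have "carry u D R T T' (\<lambda>n. 3 * (1/2)^n)"
  proof
    show "R n \<inter> D k = {}" if "n < k" for n k using Zmono[OF that] g(3)[of k] by blast
    show "summable (\<lambda>n. 3 * (1/2)^n :: real)" by (intro summable_mult summable_geometric) simp
  qed (use g in blast)+
  then interpret carry u D R T T' "\<lambda>n. 3 * (1/2)^n" .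
  obtain \<Phi> \<Psi> where lim: "supported_homeo (insert u (\<Union>n. D n)) (insert u (\<Union>n. R n)) \<Phi> \<Psi>"
    "\<And>x. (\<lambda>n. stage T n x u) \<longlonglongrightarrow> \<Phi> x u"
    using carry_limit by metis
  obtain v where v: "v \<in> D 0" using start(2) by blast
  show thesis
  proof (rule that[OF lim(1)])
    show "insert u (\<Union>n. D n) \<subseteq> P" using g(3) first(1) by blast
    show "countable (insert u (\<Union>n. R n))" using g(2) by simp
    show "v \<noteq> u" using v uD by blast
    show "v \<in> insert u (\<Union>n. D n)" using v by blast
    fix x assume x: "x \<in> X"
    have mem: "stage T n x \<in> Y n" for n by (induction n) (use x start succ in auto)
    have "(\<lambda>n. stage T (Suc n) x u) \<longlonglongrightarrow> 0"
    proof (rule Lim_null_comparison)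
      show "\<forall>\<^sub>F n in sequentially. norm (stage T (Suc n) x u) \<le> (1/2)^n"
        using g(4)[OF mem] by simp
      show "(\<lambda>n. (1/2)^n :: real) \<longlonglongrightarrow> 0" by (rule LIMSEQ_power_zero) simp
    qed
    then have "(\<lambda>n. stage T n x u) \<longlonglongrightarrow> 0" by (rule LIMSEQ_imp_Suc)
    then show "\<Phi> x u = 0" using lim(2) LIMSEQ_unique by blast
  qed blast
qed

section \<open>Combining blocks by transfinite recursion\<close>

lemma supported_homeoD:
  assumes "supported_homeo D R T T'"
  shows "continuous_on UNIV T" "continuous_on UNIV T'" "T' (T x) = x" "T (T' x) = x" "D \<subseteq> R"
    "i \<notin> D \<Longrightarrow> T x i = x i" "i \<notin> D \<Longrightarrow> T' x i = x i"
    "i \<in> D \<Longrightarrow> depends_on (\<lambda>x. T x i) R" "i \<in> D \<Longrightarrow> depends_on (\<lambda>x. T' x i) R"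
proof -
  show *: "i \<notin> D \<Longrightarrow> T x i = x i" for x i using assms by (simp add: supported_homeo_def)
  show "T (T' x) = x" for x using assms by (simp add: supported_homeo_def)
  then show "i \<notin> D \<Longrightarrow> T' x i = x i" using *[of i "T' x"] by simp
qed (use assms in \<open>auto simp: supported_homeo_def\<close>)

text \<open>
  Simultaneous application, all blocks reading the original coordinates. For the inverse, block a needs the
  original values of the coordinates at which it looks and which do not belong to it; these are untouched or belong to
  earlier blocks, so they can be recovered by well-founded recursion.
\<close>
lemma triangular_homeo:
  fixes D R :: "'j \<Rightarrow> 'i set"
  assumes wf: "wf r"
    and block: "\<And>a. a \<in> J \<Longrightarrow> supported_homeo (D a) (R a) (\<Phi> a) (\<Psi> a)"
    and disjoint: "\<And>a b. a \<in> J \<Longrightarrow> b \<in> J \<Longrightarrow> a \<noteq> b \<Longrightarrow> D a \<inter> D b = {}"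
    and order: "\<And>a b. a \<in> J \<Longrightarrow> b \<in> J \<Longrightarrow> a \<noteq> b \<Longrightarrow> R a \<inter> D b \<noteq> {} \<Longrightarrow> (b, a) \<in> r"
  obtains F G where "supported_homeo (\<Union>a\<in>J. D a) UNIV F G"
    "\<And>a i x. a \<in> J \<Longrightarrow> i \<in> D a \<Longrightarrow> F x i = \<Phi> a x i"
proof -
  define idx where "idx i = (THE a. a \<in> J \<and> i \<in> D a)" for i
  have idx: "idx i = a" if "a \<in> J" "i \<in> D a" for i a
    unfolding idx_def
  proof (rule the_equality)
    show "b = a" if "b \<in> J \<and> i \<in> D b" for b using disjoint[of b a] that \<open>a \<in> J\<close> \<open>i \<in> D a\<close> by blast
  qed (use that in blast)
  \<comment> \<open>Where block a looks, this agrees with \<open>\<Phi> a x\<close> for the original point x: the new values in D a, and elsewhere the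
    old values, recovered by the inverses g of the earlier blocks.\<close>
  define pre where "pre a g y = (\<lambda>i. if i \<in> D a then y i
      else if \<exists>b\<in>J. i \<in> D b \<and> (b, a) \<in> r then g (idx i) y i else y i)"
    for a and g :: "'j \<Rightarrow> ('i \<Rightarrow> real) \<Rightarrow> 'i \<Rightarrow> real" and y
  have "\<exists>g. \<forall>a. g a = (\<lambda>y. \<Psi> a (pre a g y))"
  proof (rule dependent_wf_choice[OF wf])
    fix f g :: "'j \<Rightarrow> ('i \<Rightarrow> real) \<Rightarrow> 'i \<Rightarrow> real" and a h
    assume fg: "\<And>b. (b, a) \<in> r \<Longrightarrow> f b = g b"
    have "pre a f y = pre a g y" for y
    proof
      fix i
      show "pre a f y i = pre a g y i"
      proof (cases "\<exists>b\<in>J. i \<in> D b \<and> (b, a) \<in> r")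
        case True
        then obtain b where b: "b \<in> J" "i \<in> D b" "(b, a) \<in> r" by blast
        show ?thesis unfolding pre_def idx[OF b(1,2)] fg[OF b(3)] ..
      next
        case False then show ?thesis by (simp only: pre_def if_False)
      qed
    qed
    then show "(h = (\<lambda>y. \<Psi> a (pre a f y))) = (h = (\<lambda>y. \<Psi> a (pre a g y)))" by simp
  qed blast
  then obtain g where g: "\<And>a y. g a y = \<Psi> a (pre a g y)" by metis
  define F where "F x i = (if \<exists>a\<in>J. i \<in> D a then \<Phi> (idx i) x i else x i)" for x i
  define G where "G y i = (if \<exists>a\<in>J. i \<in> D a then g (idx i) y i else y i)" for y i
  have F: "F x i = \<Phi> a x i" and G: "G y i = g a y i" if "a \<in> J" "i \<in> D a" for a i x y
  proof -
    have "\<exists>a\<in>J. i \<in> D a" using that by blast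
    then show "F x i = \<Phi> a x i" "G y i = g a y i" by (simp_all only: F_def G_def idx[OF that] if_True)
  qed
  have FN: "F x i = x i" and GN: "G y i = y i" if "\<not> (\<exists>a\<in>J. i \<in> D a)" for i x y
    using that by (simp_all only: F_def G_def if_False)
  \<comment> \<open>Where block a looks, each coordinate is its own, or untouched, or belongs to an earlier block.\<close>
  have pre_R: "pre a g y j = (if j \<in> D a then y j else G y j)" if a: "a \<in> J" and j: "j \<in> R a" for a j y
  proof (cases "j \<in> D a")
    case True then show ?thesis by (simp add: pre_def)
  next
    case False
    show ?thesis
    proof (cases "\<exists>b\<in>J. j \<in> D b")
      case True
      then obtain b where b: "b \<in> J" "j \<in> D b" by blast
      then have "(b, a) \<in> r" using order[of a b] a j False by blast
      then have "\<exists>b\<in>J. j \<in> D b \<and> (b, a) \<in> r" using b by blast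
      then show ?thesis using False G[OF b] by (simp add: pre_def idx[OF b])
    next
      case none: False
      then have "(\<exists>b\<in>J. j \<in> D b \<and> (b, a) \<in> r) = False" by blast
      then show ?thesis using False by (simp only: pre_def if_False GN[OF none])
    qed
  qed
  have right_inverse: "F (G y) = y" for y
  proof
    fix i
    show "F (G y) i = y i"
    proof (cases "\<exists>a\<in>J. i \<in> D a")
      case True
      then obtain a where a: "a \<in> J" "i \<in> D a" by blast
      note S = supported_homeoD[OF block[OF a(1)]]
      have "F (G y) i = \<Phi> a (G y) i" by (rule F[OF a])
      also have "\<dots> = \<Phi> a (\<Psi> a (pre a g y)) i"
      proof (rule depends_onD[OF S(8)[OF a(2)]])
        fix j assume j: "j \<in> R a"
        show "G y j = \<Psi> a (pre a g y) j"
        proof (cases "j \<in> D a")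
          case True show ?thesis unfolding G[OF a(1) True] g[of a y] by (rule refl)
        next
          case False then show ?thesis using pre_R[OF a(1) j] S(7)[OF False] by simp
        qed
      qed
      also have "\<dots> = y i" using a(2) by (simp add: S(4) pre_def)
      finally show ?thesis .
    next
      case False show ?thesis unfolding FN[OF False] GN[OF False] by (rule refl)
    qed
  qed
  have undo: "\<forall>i\<in>D a. a \<in> J \<longrightarrow> G (F x) i = x i" for a x
    using wf
  proof (induction a rule: wf_induct_rule)
    case (less a)
    show ?case
    proof (intro ballI impI)
      fix i assume a: "i \<in> D a" "a \<in> J"
      note S = supported_homeoD[OF block[OF a(2)]]
      have "G (F x) i = \<Psi> a (pre a g (F x)) i" unfolding G[OF a(2,1)] g[of a "F x"] by (rule refl)
      also have "\<dots> = \<Psi> a (\<Phi> a x) i"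
      proof (rule depends_onD[OF S(9)[OF a(1)]])
        fix j assume j: "j \<in> R a"
        show "pre a g (F x) j = \<Phi> a x j"
        proof (cases "j \<in> D a")
          case True then show ?thesis using pre_R[OF a(2) j] F[OF a(2) True] by simp
        next
          case False
          have "G (F x) j = x j"
          proof (cases "\<exists>b\<in>J. j \<in> D b")
            case True
            then obtain b where b: "b \<in> J" "j \<in> D b" by blast
            then have "(b, a) \<in> r" using order[of a b] a j False by blast
            from less[OF this] b show ?thesis by blast
          next
            case none: False show ?thesis unfolding FN[OF none] GN[OF none] by (rule refl)
          qed
          then show ?thesis using pre_R[OF a(2) j] S(6)[OF False] False by simp
        qed
      qed
      also have "\<dots> = x i" by (simp only: S(3))
      finally show "G (F x) i = x i" .
    qed
  qed
  have left_inverse: "G (F x) = x" for x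
  proof
    fix i show "G (F x) i = x i"
    proof (cases "\<exists>a\<in>J. i \<in> D a")
      case True then show ?thesis using undo by blast
    next
      case False show ?thesis unfolding FN[OF False] GN[OF False] by (rule refl)
    qed
  qed
  have cont_F: "continuous_on UNIV F"
  proof (rule continuous_on_coordinatewise_then_product)
    fix i
    show "continuous_on UNIV (\<lambda>x. F x i)"
    proof (cases "\<exists>a\<in>J. i \<in> D a")
      case True
      then obtain a where a: "a \<in> J" "i \<in> D a" by blast
      show ?thesis unfolding F[OF a]
        by (rule continuous_on_product_then_coordinatewise[OF supported_homeoD(1)[OF block[OF a(1)]]])
    next
      case False show ?thesis unfolding FN[OF False] by (rule continuous_on_product_coordinates)
    qed
  qed
  have cont_g: "a \<in> J \<longrightarrow> continuous_on UNIV (g a)" for a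
    using wf
  proof (induction a rule: wf_induct_rule)
    case (less a)
    show ?case
    proof
      assume a: "a \<in> J"
      have "continuous_on UNIV (pre a g)"
      proof (rule continuous_on_coordinatewise_then_product)
        fix i
        show "continuous_on UNIV (\<lambda>y. pre a g y i)"
        proof (cases "i \<notin> D a \<and> (\<exists>b\<in>J. i \<in> D b \<and> (b, a) \<in> r)")
          case True
          then obtain b where b: "b \<in> J" "i \<in> D b" "(b, a) \<in> r" by blast
          have "continuous_on UNIV (g b)" using less[OF b(3)] b(1) by blast
          then have "continuous_on UNIV (\<lambda>y. g b y i)" by (rule continuous_on_product_then_coordinatewise)
          then show ?thesis using True by (simp add: pre_def idx[OF b(1,2)])
        next
          case False
          then have "pre a g y i = y i" for y by (auto simp: pre_def)
          then show ?thesis by (simp only: continuous_on_product_coordinates)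
        qed
      qed
      then have "continuous_on UNIV (\<lambda>y. \<Psi> a (pre a g y))"
        by (intro continuous_on_compose2[OF supported_homeoD(2)[OF block[OF a]]]) auto
      moreover have "g a = (\<lambda>y. \<Psi> a (pre a g y))" by (rule ext) (rule g)
      ultimately show "continuous_on UNIV (g a)" by (rule ssubst[rotated])
    qed
  qed
  have cont_G: "continuous_on UNIV G"
  proof (rule continuous_on_coordinatewise_then_product)
    fix i
    show "continuous_on UNIV (\<lambda>x. G x i)"
    proof (cases "\<exists>a\<in>J. i \<in> D a")
      case True
      then obtain a where a: "a \<in> J" "i \<in> D a" by blast
      have "continuous_on UNIV (g a)" using cont_g a(1) by blast
      then show ?thesis unfolding G[OF a] by (rule continuous_on_product_then_coordinatewise)
    next
      case False show ?thesis unfolding GN[OF False] by (rule continuous_on_product_coordinates)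
    qed
  qed
  have "supported_homeo (\<Union>a\<in>J. D a) UNIV F G"
    unfolding supported_homeo_def
  proof (intro conjI)
    show "\<forall>x i. i \<notin> (\<Union>a\<in>J. D a) \<longrightarrow> F x i = x i" using FN by blast
  qed (use left_inverse right_inverse cont_F cont_G in \<open>simp_all add: depends_on_UNIV\<close>)
  then show thesis by (rule that) (rule F)
qed

lemma countable_card_le_infinite:
  assumes "countable A" "infinite B" shows "(card_of A, card_of B) \<in> ordLeq"
proof -
  obtain g :: "nat \<Rightarrow> 'b" where g: "inj g" "range g \<subseteq> B"
    using infinite_countable_subset[OF assms(2)] by blast
  have "inj_on (g \<circ> to_nat_on A) A"
    using g(1) assms(1) by (intro comp_inj_on inj_on_to_nat_on) (auto intro: inj_on_subset)
  moreover have "(g \<circ> to_nat_on A) ` A \<subseteq> B" using g(2) by auto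
  ultimately show ?thesis using card_of_ordLeq by blast
qed

text \<open>
  A proper initial segment of the cardinal order of I has smaller cardinality than I, hence so has a union of
  countable sets indexed by it, unless the segment is finite, in which case the union is countable.
\<close>
lemma uncountable_minus_few_countable:
  assumes I: "uncountable I" and a: "a \<in> I"
    and R: "\<And>b. b \<in> underS (card_of I) a \<Longrightarrow> countable (R b)"
  shows "uncountable (I - (\<Union>b\<in>underS (card_of I) a. R b))"
proof
  let ?S = "underS (card_of I) a"
  assume count: "countable (I - (\<Union>b\<in>?S. R b))"
  have sub: "I \<subseteq> (\<Union>b\<in>?S. R b) \<union> (I - (\<Union>b\<in>?S. R b))" by blast
  show False
  proof (cases "finite ?S")
    case True
    then have "countable ((\<Union>b\<in>?S. R b) \<union> (I - (\<Union>b\<in>?S. R b)))"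
      using R count by (intro countable_Un countable_UN) (auto intro: countable_finite)
    then show False using I sub countable_subset by blast
  next
    case False
    have "(card_of (\<Union>b\<in>?S. R b), card_of ?S) \<in> ordLeq"
    proof (rule card_of_UNION_ordLeq_infinite[OF False])
      show "(card_of ?S, card_of ?S) \<in> ordLeq" by (rule card_of_mono1) simp
      show "\<forall>b\<in>?S. (card_of (R b), card_of ?S) \<in> ordLeq"
        using R False by (blast intro: countable_card_le_infinite)
    qed
    then have "(card_of ((\<Union>b\<in>?S. R b) \<union> (I - (\<Union>b\<in>?S. R b))), card_of ?S) \<in> ordLeq"
      using countable_card_le_infinite[OF count False] False
      by (intro card_of_Un_ordLeq_infinite_Field) (simp_all add: Field_card_of card_of_card_order_on)
    then have "(card_of I, card_of ?S) \<in> ordLeq"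
      using card_of_mono1[OF sub] ordLeq_transitive by blast
    moreover have "(card_of ?S, card_of I) \<in> ordLess"
      by (rule card_of_underS[OF card_of_Card_order]) (simp add: a Field_card_of)
    ultimately show False using not_ordLess_ordLeq by blast
  qed
qed

text \<open>
  One block for every a \<in> I, moving only coordinates at which no earlier block looks. The coordinates u a
  form K and the coordinates v a lie outside K, so both K and I - K have the cardinality of I.
\<close>
lemma flattening_homeo:
  fixes X :: "('i \<Rightarrow> real) set"
  assumes X: "Lindelof_space (top_of_set X)" "separated_from_zero_sets X" and I: "uncountable I"
  obtains F G D K \<sigma> where "supported_homeo D UNIV F G" "D \<subseteq> I" "K \<subseteq> I" "bij_betw \<sigma> K (I - K)"
    "\<And>x k. x \<in> X \<Longrightarrow> k \<in> K \<Longrightarrow> F x k = 0"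
proof -
  define r where "r = card_of I - Id"
  have wo: "Well_order (card_of I)" by (rule card_of_Well_order)
  have wf: "wf r" using wo unfolding r_def well_order_on_def by blast
  have underS: "underS (card_of I) a = {b. (b, a) \<in> r}" for a by (auto simp: underS_def r_def)
  have rI: "a \<in> I" "b \<in> I" if "(b, a) \<in> r" for a b
    using that Field_card_of[of I] by (auto simp: r_def Field_def)
  have total: "(a, b) \<in> r \<or> (b, a) \<in> r" if "a \<in> I" "b \<in> I" "a \<noteq> b" for a b
    using wo that unfolding well_order_on_def linear_order_on_def total_on_def r_def Field_card_of by blast
  define blk where "blk Z = (\<lambda>(u, v, D, R, \<Phi>, \<Psi>). supported_homeo D R \<Phi> \<Psi> \<and> D \<subseteq> I - Z \<and> countable R \<and>
      u \<in> D \<and> v \<in> D \<and> v \<noteq> u \<and> (\<forall>x\<in>X. \<Phi> x u = 0))"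
    for Z
  define Rof where "Rof s = fst (snd (snd (snd s)))"
    for s :: "'i \<times> 'i \<times> 'i set \<times> 'i set \<times> (('i \<Rightarrow> real) \<Rightarrow> 'i \<Rightarrow> real) \<times> (('i \<Rightarrow> real) \<Rightarrow> 'i \<Rightarrow> real)"
  have "\<exists>f. \<forall>a. a \<in> I \<longrightarrow> blk (\<Union>b\<in>{b. (b, a) \<in> r}. Rof (f b)) (f a)"
  proof (rule dependent_wf_choice[OF wf])
    fix f g :: "'i \<Rightarrow> 'i \<times> 'i \<times> 'i set \<times> 'i set \<times> (('i \<Rightarrow> real) \<Rightarrow> 'i \<Rightarrow> real) \<times> (('i \<Rightarrow> real) \<Rightarrow> 'i \<Rightarrow> real)" and a s
    assume "\<And>b. (b, a) \<in> r \<Longrightarrow> f b = g b"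
    then show "(a \<in> I \<longrightarrow> blk (\<Union>b\<in>{b. (b, a) \<in> r}. Rof (f b)) s) = (a \<in> I \<longrightarrow> blk (\<Union>b\<in>{b. (b, a) \<in> r}. Rof (g b)) s)"
      by simp
  next
    fix a and f :: "'i \<Rightarrow> 'i \<times> 'i \<times> 'i set \<times> 'i set \<times> (('i \<Rightarrow> real) \<Rightarrow> 'i \<Rightarrow> real) \<times> (('i \<Rightarrow> real) \<Rightarrow> 'i \<Rightarrow> real)"
    assume f: "\<And>b. (b, a) \<in> r \<Longrightarrow> b \<in> I \<longrightarrow> blk (\<Union>c\<in>{c. (c, b) \<in> r}. Rof (f c)) (f b)"
    show "\<exists>s. a \<in> I \<longrightarrow> blk (\<Union>b\<in>{b. (b, a) \<in> r}. Rof (f b)) s"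
    proof (cases "a \<in> I")
      case True
      let ?Z = "\<Union>b\<in>{b. (b, a) \<in> r}. Rof (f b)"
      have "countable (Rof (f b))" if "(b, a) \<in> r" for b
        using f[OF that] rI(2)[OF that] by (auto simp: blk_def Rof_def split: prod.splits)
      then have unc: "uncountable (I - ?Z)"
        using uncountable_minus_few_countable[OF I True, of "\<lambda>b. Rof (f b)"] unfolding underS by blast
      obtain u v D R \<Phi> \<Psi> where "supported_homeo D R \<Phi> \<Psi>" "D \<subseteq> I - ?Z" "countable R" "u \<in> D" "v \<in> D" "v \<noteq> u"
        "\<And>x. x \<in> X \<Longrightarrow> \<Phi> x u = 0"
        by (rule flattening_block[OF X unc], rule that, assumption+)
      then have "blk ?Z (u, v, D, R, \<Phi>, \<Psi>)" unfolding blk_def by simp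
      then show ?thesis by blast
    qed blast
  qed
  then obtain f where f: "\<And>a. a \<in> I \<Longrightarrow> blk (\<Union>b\<in>{b. (b, a) \<in> r}. Rof (f b)) (f a)" by blast
  define u where "u a = fst (f a)" for a
  define v where "v a = fst (snd (f a))" for a
  define D where "D a = fst (snd (snd (f a)))" for a
  define R where "R a = Rof (f a)" for a
  define \<Phi> where "\<Phi> a = fst (snd (snd (snd (snd (f a)))))" for a
  define \<Psi> where "\<Psi> a = snd (snd (snd (snd (snd (f a)))))" for a
  have feq: "f a = (u a, v a, D a, R a, \<Phi> a, \<Psi> a)" for a
    by (simp add: u_def v_def D_def R_def Rof_def \<Phi>_def \<Psi>_def)
  have g: "supported_homeo (D a) (R a) (\<Phi> a) (\<Psi> a)" "D a \<subseteq> I - (\<Union>b\<in>{b. (b, a) \<in> r}. R b)"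
      "u a \<in> D a" "v a \<in> D a" "v a \<noteq> u a" "\<And>x. x \<in> X \<Longrightarrow> \<Phi> a x (u a) = 0" if "a \<in> I" for a
    using f[OF that] unfolding feq[of a] blk_def R_def[symmetric] prod.case by blast+
  have earlier: "R a \<inter> D b = {}" if "(a, b) \<in> r" for a b using g(2)[OF rI(1)[OF that]] that by blast
  have DR: "D a \<subseteq> R a" if "a \<in> I" for a by (rule supported_homeoD(5)[OF g(1)[OF that]])
  have order: "(b, a) \<in> r" if "a \<in> I" "b \<in> I" "a \<noteq> b" "R a \<inter> D b \<noteq> {}" for a b
    using total[OF that(1-3)] earlier that(4) by blast
  have disjoint: "D a \<inter> D b = {}" if "a \<in> I" "b \<in> I" "a \<noteq> b" for a b
    using total[OF that] earlier[of a b] earlier[of b a] DR[OF that(1)] DR[OF that(2)] by blast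
  obtain F G where FG: "supported_homeo (\<Union>a\<in>I. D a) UNIV F G"
      "\<And>a i x. a \<in> I \<Longrightarrow> i \<in> D a \<Longrightarrow> F x i = \<Phi> a x i"
    by (rule triangular_homeo[OF wf g(1) disjoint order], assumption+, rule that, assumption+)
  have same: "a = b" if "a \<in> I" "b \<in> I" "i \<in> D a" "i \<in> D b" for a b i
    using disjoint[OF that(1,2)] that(3,4) by blast
  have inj: "inj_on u I" "inj_on v I"
  proof -
    show "inj_on u I" by (rule inj_onI, rule same[OF _ _ g(3)]) (simp_all add: g(3))
    show "inj_on v I" by (rule inj_onI, rule same[OF _ _ g(4)]) (simp_all add: g(4))
  qed
  have uv: "u a \<noteq> v b" if "a \<in> I" "b \<in> I" for a b
  proof
    assume eq: "u a = v b"
    have "v b \<in> D a" using g(3)[OF that(1)] eq by simp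
    then have "a = b" by (rule same[OF that _ g(4)[OF that(2)]])
    then show False using g(5)[OF that(2)] eq by simp
  qed
  have in_I: "u a \<in> I" "v a \<in> I" if "a \<in> I" for a using g(2,3,4)[OF that] by blast+
  have "\<exists>\<sigma>. bij_betw \<sigma> (u ` I) (I - u ` I)"
  proof (rule Schroeder_Bernstein)
    show "inj_on (v \<circ> the_inv_into I u) (u ` I)"
      by (rule comp_inj_on[OF inj_on_the_inv_into[OF inj(1)]]) (simp add: the_inv_into_onto[OF inj(1)] inj(2))
    show "(v \<circ> the_inv_into I u) ` u ` I \<subseteq> I - u ` I"
      unfolding image_comp[symmetric] the_inv_into_onto[OF inj(1)] using in_I(2) uv by force
    show "inj_on u (I - u ` I)" using inj(1) by (rule inj_on_subset) blast
    show "u ` (I - u ` I) \<subseteq> u ` I" by blast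
  qed
  then obtain \<sigma> where \<sigma>: "bij_betw \<sigma> (u ` I) (I - u ` I)" ..
  show thesis
  proof (rule that[OF FG(1) _ _ \<sigma>])
    show "(\<Union>a\<in>I. D a) \<subseteq> I" using g(2) by blast
    show "u ` I \<subseteq> I" using in_I by blast
    fix x k assume "x \<in> X" "k \<in> u ` I"
    then show "F x k = 0" using FG(2) g(3,6) by force
  qed
qed

section \<open>Extending homeomorphisms between flat sets\<close>

lemma supported_homeo_UNIV:
  "supported_homeo D UNIV T T' \<longleftrightarrow> continuous_on UNIV T \<and> continuous_on UNIV T' \<and>
    (\<forall>x. T' (T x) = x) \<and> (\<forall>x. T (T' x) = x) \<and> (\<forall>x i. i \<notin> D \<longrightarrow> T x i = x i)"
  by (simp add: supported_homeo_def depends_on_UNIV)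

lemma supported_homeo_compose:
  assumes "supported_homeo D UNIV S S'" "supported_homeo D UNIV T T'"
  shows "supported_homeo D UNIV (\<lambda>x. T (S x)) (\<lambda>x. S' (T' x))"
proof -
  note S = supported_homeoD[OF assms(1)] and T = supported_homeoD[OF assms(2)]
  have "continuous_on UNIV (\<lambda>x. T (S x))" by (rule continuous_on_compose2[OF T(1) S(1)]) simp
  moreover have "continuous_on UNIV (\<lambda>x. S' (T' x))" by (rule continuous_on_compose2[OF S(2) T(2)]) simp
  ultimately show ?thesis using assms by (simp add: supported_homeo_UNIV)
qed

lemma supported_homeo_inverse:
  assumes "supported_homeo D UNIV T T'" shows "supported_homeo D UNIV T' T"
  using assms supported_homeoD(7)[OF assms] by (simp add: supported_homeo_UNIV)

lemma supported_homeo_mono: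
  "supported_homeo D UNIV T T' \<Longrightarrow> D \<subseteq> E \<Longrightarrow> supported_homeo E UNIV T T'"
  unfolding supported_homeo_UNIV by blast

lemma supported_homeo_shear:
  fixes p :: "'i \<Rightarrow> ('i \<Rightarrow> real) \<Rightarrow> real"
  assumes p: "\<And>i. continuous_on UNIV (p i)" "\<And>i x y. (\<And>j. j \<notin> S \<Longrightarrow> x j = y j) \<Longrightarrow> p i x = p i y"
  shows "supported_homeo S UNIV (\<lambda>x i. if i \<in> S then x i + p i x else x i) (\<lambda>x i. if i \<in> S then x i - p i x else x i)"
  unfolding supported_homeo_UNIV
proof (intro conjI allI)
  have "continuous_on UNIV (\<lambda>x. if i \<in> S then x i + p i x else x i)"
    "continuous_on UNIV (\<lambda>x. if i \<in> S then x i - p i x else x i)" for i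
    by (cases "i \<in> S"; auto intro!: continuous_intros p(1))+
  then show "continuous_on UNIV (\<lambda>x i. if i \<in> S then x i + p i x else x i)"
    "continuous_on UNIV (\<lambda>x i. if i \<in> S then x i - p i x else x i)"
    by (auto intro!: continuous_on_coordinatewise_then_product)
next
  fix x :: "'i \<Rightarrow> real"
  have "p i (\<lambda>i. if i \<in> S then x i + p i x else x i) = p i x"
    "p i (\<lambda>i. if i \<in> S then x i - p i x else x i) = p i x" for i
    by (rule p(2), simp)+
  then show "(\<lambda>i. if i \<in> S then (\<lambda>i. if i \<in> S then x i + p i x else x i) i - p i (\<lambda>i. if i \<in> S then x i + p i x else x i)
      else (\<lambda>i. if i \<in> S then x i + p i x else x i) i) = x"
    "(\<lambda>i. if i \<in> S then (\<lambda>i. if i \<in> S then x i - p i x else x i) i + p i (\<lambda>i. if i \<in> S then x i - p i x else x i)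
      else (\<lambda>i. if i \<in> S then x i - p i x else x i) i) = x"
    by (auto simp: fun_eq_iff)
qed simp

lemma C_embedded_in_euclideanD:
  assumes "C_embedded_in euclidean A" "continuous_on A (f :: _ \<Rightarrow> real)"
  obtains g where "continuous_on UNIV g" "\<And>z. z \<in> A \<Longrightarrow> g z = f z"
  using assms unfolding C_embedded_in_def by auto

text \<open>
  Klee's trick. The involution \<pi> exchanges K and I - K. The shear s1 writes the coordinates of f, permuted by
  \<pi>, into the free slots K, and s2 uses the inverse g to erase the original
  coordinates in I - K. The auxiliary functions p' and q' evaluate the extensions after the coordinates to be sheared
  have been set to zero; on the sets in question they are zero anyway, and this makes both maps invertible.
\<close>
lemma extend_between_flat_sets:
  fixes A B :: "('i \<Rightarrow> real) set"
  assumes K: "K \<subseteq> I" "bij_betw \<sigma> K (I - K)"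
    and flat: "\<And>x k. x \<in> A \<union> B \<Longrightarrow> k \<in> K \<Longrightarrow> x k = 0"
    and emb: "C_embedded_in euclidean A" "C_embedded_in euclidean B"
    and f: "continuous_on A f" "\<And>x. x \<in> A \<Longrightarrow> f x \<in> B" "\<And>x i. x \<in> A \<Longrightarrow> i \<notin> I \<Longrightarrow> f x i = x i"
    and g: "continuous_on B g" "\<And>x. x \<in> A \<Longrightarrow> g (f x) = x"
  obtains h h' where "supported_homeo I UNIV h h'" "\<And>x. x \<in> A \<Longrightarrow> h x = f x"
proof -
  define \<pi> where "\<pi> i = (if i \<in> K then \<sigma> i else if i \<in> I then the_inv_into K \<sigma> i else i)" for i
  have inj: "inj_on \<sigma> K" and img: "\<sigma> ` K = I - K" using K(2) by (auto simp: bij_betw_def)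
  have \<pi>K: "\<pi> i \<in> I - K" "\<pi> (\<pi> i) = i" if "i \<in> K" for i
  proof -
    show *: "\<pi> i \<in> I - K" using that img by (auto simp: \<pi>_def)
    then show "\<pi> (\<pi> i) = i" using that the_inv_into_f_f[OF inj that] by (simp add: \<pi>_def)
  qed
  have \<pi>I: "\<pi> i \<in> K" "\<pi> (\<pi> i) = i" if "i \<in> I - K" for i
  proof -
    have i: "i \<in> \<sigma> ` K" using that img by blast
    show *: "\<pi> i \<in> K" using that the_inv_into_into[OF inj i order_refl] by (simp add: \<pi>_def)
    have "\<pi> i = the_inv_into K \<sigma> i" using that by (simp add: \<pi>_def)
    then show "\<pi> (\<pi> i) = i" using * f_the_inv_into_f[OF inj i] by (simp add: \<pi>_def)
  qed
  have \<pi>N: "\<pi> i = i" if "i \<notin> I" for i using that K(1) by (auto simp: \<pi>_def)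
  have \<pi>\<pi>: "\<pi> (\<pi> i) = i" for i using \<pi>K \<pi>I \<pi>N by (metis DiffI)
  define perm where "perm x = (\<lambda>i. x (\<pi> i))" for x :: "'i \<Rightarrow> real"
  have perm: "supported_homeo I UNIV perm perm"
    unfolding supported_homeo_UNIV perm_def
    by (auto simp: \<pi>\<pi> \<pi>N intro!: continuous_on_coordinatewise_then_product)
  define zero where "zero S x = (\<lambda>i. if i \<in> S then 0 else x i)" for S and x :: "'i \<Rightarrow> real"
  have cont_zero: "continuous_on UNIV (zero S)" for S
    unfolding zero_def
  proof (rule continuous_on_coordinatewise_then_product)
    fix i show "continuous_on UNIV (\<lambda>x. if i \<in> S then 0 else x i :: real)" by (cases "i \<in> S") auto
  qed
  have zero_cong: "zero S x = zero S y" if "\<And>j. j \<notin> S \<Longrightarrow> x j = y j" for S x y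
    using that by (auto simp: zero_def)
  have "\<exists>p. continuous_on UNIV p \<and> (\<forall>x\<in>A. p x = f x (\<pi> i))" for i
    using C_embedded_in_euclideanD[OF emb(1) continuous_on_product_then_coordinatewise[OF f(1)]] by metis
  then obtain p where p: "\<And>i. continuous_on UNIV (p i)" "\<And>i x. x \<in> A \<Longrightarrow> p i x = f x (\<pi> i)" by metis
  have "\<exists>q. continuous_on UNIV q \<and> (\<forall>y\<in>B. q y = g y i)" for i
    using C_embedded_in_euclideanD[OF emb(2) continuous_on_product_then_coordinatewise[OF g(1)]] by metis
  then obtain q where q: "\<And>i. continuous_on UNIV (q i)" "\<And>i y. y \<in> B \<Longrightarrow> q i y = g y i" by metis
  define p' where "p' i x = p i (zero K x)" for i x
  define q' where "q' i x = q i (perm (zero (I - K) x))" for i x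
  define s1 where "s1 x = (\<lambda>i. if i \<in> K then x i + p' i x else x i)" for x
  define s1' where "s1' x = (\<lambda>i. if i \<in> K then x i - p' i x else x i)" for x
  define s2 where "s2 x = (\<lambda>i. if i \<in> I - K then x i - q' i x else x i)" for x
  define s2' where "s2' x = (\<lambda>i. if i \<in> I - K then x i + q' i x else x i)" for x
  have "supported_homeo K UNIV s1 s1'"
    unfolding s1_def[abs_def] s1'_def[abs_def]
  proof (rule supported_homeo_shear)
    show "continuous_on UNIV (p' i)" for i unfolding p'_def
      by (intro continuous_on_compose2[OF p(1) cont_zero]) auto
    show "p' i x = p' i y" if "\<And>j. j \<notin> K \<Longrightarrow> x j = y j" for i x y
    proof -
      have "zero K x = zero K y" by (rule zero_cong) (rule that)
      then show ?thesis by (simp only: p'_def)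
    qed
  qed
  then have s1: "supported_homeo I UNIV s1 s1'" using K(1) by (rule supported_homeo_mono)
  have cont_perm: "continuous_on UNIV perm" using perm by (simp add: supported_homeo_UNIV)
  have shear2: "supported_homeo (I - K) UNIV s2' s2"
    unfolding s2_def[abs_def] s2'_def[abs_def]
  proof (rule supported_homeo_shear)
    have "continuous_on UNIV (\<lambda>x. perm (zero (I - K) x))"
      by (rule continuous_on_compose2[OF cont_perm cont_zero]) simp
    then show "continuous_on UNIV (q' i)" for i unfolding q'_def
      by (rule continuous_on_compose2[OF q(1)]) simp
    show "q' i x = q' i y" if "\<And>j. j \<notin> I - K \<Longrightarrow> x j = y j" for i x y
    proof -
      have "zero (I - K) x = zero (I - K) y" by (rule zero_cong) (rule that)
      then show ?thesis by (simp only: q'_def)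
    qed
  qed
  have s2: "supported_homeo I UNIV s2 s2'"
    by (rule supported_homeo_mono[OF supported_homeo_inverse[OF shear2]]) blast
  have "supported_homeo I UNIV (\<lambda>x. perm (s2 (s1 x))) (\<lambda>x. s1' (s2' (perm x)))"
    using supported_homeo_compose[OF supported_homeo_compose[OF s1 s2] perm] .
  moreover have "perm (s2 (s1 a)) = f a" if a: "a \<in> A" for a
  proof -
    have fa: "f a \<in> B" by (rule f(2)[OF a])
    have aK: "a k = 0" if "k \<in> K" for k using flat[of a k] a that by blast
    have "zero K a = a" by (simp add: zero_def fun_eq_iff aK)
    then have "p' i a = f a (\<pi> i)" for i by (simp only: p'_def p(2)[OF a])
    then have s1a: "s1 a i = (if i \<in> K then f a (\<pi> i) else a i)" for i by (simp add: s1_def aK)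
    \<comment> \<open>The point \<open>s1 a\<close> is (a, f a) on the graph of f; its part in K determines the whole of \<open>f a\<close>.\<close>
    have graph: "perm (zero (I - K) (s1 a)) = f a"
    proof
      fix j
      show "perm (zero (I - K) (s1 a)) j = f a j"
      proof (cases "j \<in> I")
        case True
        show ?thesis
        proof (cases "j \<in> K")
          case True
          then have "perm (zero (I - K) (s1 a)) j = 0" using \<pi>K(1)[OF True] by (simp add: perm_def zero_def)
          also have "\<dots> = f a j" using flat[of "f a" j] fa True by simp
          finally show ?thesis .
        next
          case False
          then have "\<pi> j \<in> K" using \<pi>I True by blast
          then show ?thesis by (simp add: perm_def zero_def s1a \<pi>\<pi>)
        qed
      next
        case False
        then have "j \<notin> K" using K(1) by blast
        then show ?thesis using False f(3)[OF a False] by (simp add: perm_def zero_def \<pi>N s1a)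
      qed
    qed
    have "s2 (s1 a) = zero (I - K) (s1 a)"
    proof
      fix i
      have "q' i (s1 a) = a i" unfolding q'_def graph by (simp add: q(2)[OF fa] g(2)[OF a])
      then show "s2 (s1 a) i = zero (I - K) (s1 a) i" by (simp add: s2_def zero_def s1a)
    qed
    then show ?thesis using graph by simp
  qed
  ultimately show thesis by (rule that)
qed

section \<open>Transfer to the topology of extensional functions\<close>

lemma powertop_real_eq: "powertop_real I = top_of_set (extensional I)"
proof -
  have sp: "topspace (powertop_real I) = topspace (top_of_set (extensional I :: ('a \<Rightarrow> real) set))"
    by (auto simp: PiE_def)
  have "continuous_map (powertop_real I) (top_of_set (extensional I)) id"
  proof -
    have coord: "continuous_map (powertop_real I) euclideanreal (\<lambda>x. x i)" for i
    proof (cases "i \<in> I")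
      case True then show ?thesis by (rule continuous_map_product_projection)
    next
      case False
      have "continuous_map (powertop_real I) euclideanreal (\<lambda>x. undefined)" by simp
      then show ?thesis
        by (rule continuous_map_eq) (use False in \<open>auto simp: PiE_def extensional_def\<close>)
    qed
    have "continuous_map (powertop_real I) (powertop_real UNIV) id"
      using coord by (simp add: continuous_map_componentwise_UNIV)
    then have "continuous_map (powertop_real I) euclidean id"
      by (simp only: euclidean_product_topology)
    then show ?thesis by (auto simp: continuous_map_in_subtopology PiE_def)
  qed
  moreover have "continuous_map (top_of_set (extensional I)) (powertop_real I) (id :: ('a \<Rightarrow> real) \<Rightarrow> _)"
    by (auto simp: continuous_map_componentwise intro!: continuous_on_subset[OF continuous_on_product_coordinates])
  ultimately show ?thesis
    using topology_finer_continuous_id[OF sp] topology_finer_continuous_id[OF sp[symmetric]]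
    by (auto simp: topology_eq)
qed

lemma C_embedded_in_euclidean:
  fixes A :: "('i \<Rightarrow> real) set"
  assumes "C_embedded_in (powertop_real I) A"
  shows "C_embedded_in euclidean A"
proof -
  have A: "A \<subseteq> extensional I"
    using assms unfolding C_embedded_in_def powertop_real_eq by simp
  have "\<exists>g. continuous_on UNIV g \<and> (\<forall>z\<in>A. g z = f z)" if f: "continuous_on A f" for f :: "_ \<Rightarrow> real"
  proof -
    have "subtopology (powertop_real I) A = top_of_set A"
      unfolding powertop_real_eq subtopology_subtopology using A by (simp add: Int_absorb1)
    then obtain g where g: "continuous_map (powertop_real I) euclideanreal g" "\<forall>z\<in>A. g z = f z"
      using assms f unfolding C_embedded_in_def by auto
    have "continuous_on (extensional I) g" using g(1) unfolding powertop_real_eq by simp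
    moreover have "continuous_on UNIV (\<lambda>x :: 'i \<Rightarrow> real. restrict x I)"
    proof (rule continuous_on_coordinatewise_then_product)
      fix i show "continuous_on UNIV (\<lambda>x :: 'i \<Rightarrow> real. restrict x I i)" by (cases "i \<in> I") auto
    qed
    ultimately have "continuous_on UNIV (\<lambda>x. g (restrict x I))"
      by (rule continuous_on_compose2) auto
    moreover have "g (restrict z I) = f z" if "z \<in> A" for z
      using g(2) that A by (auto simp: extensional_restrict)
    ultimately show ?thesis by blast
  qed
  then show ?thesis unfolding C_embedded_in_def by simp
qed

text \<open>
  The reciprocal of w extends from A and from B separately, and the larger of the two extensions serves for the union.
\<close>
lemma C_embedded_union_separated:
  fixes A B :: "'a::topological_space set"
  assumes "C_embedded_in euclidean A" "C_embedded_in euclidean B"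
  shows "separated_from_zero_sets (A \<union> B)"
  unfolding separated_from_zero_sets_def
proof (intro allI impI)
  fix w :: "'a \<Rightarrow> real" assume w: "continuous_on UNIV w" "\<forall>x\<in>A \<union> B. 0 < w x"
  have cont: "continuous_on S (\<lambda>x. 1 / w x)" if "S \<subseteq> A \<union> B" for S
    using w that by (intro continuous_on_divide continuous_on_const continuous_on_subset[OF w(1)]) force+
  obtain H where H: "continuous_on UNIV H" "\<And>x. x \<in> A \<Longrightarrow> H x = 1 / w x"
    using C_embedded_in_euclideanD[OF assms(1) cont] by blast
  obtain H' where H': "continuous_on UNIV H'" "\<And>x. x \<in> B \<Longrightarrow> H' x = 1 / w x"
    using C_embedded_in_euclideanD[OF assms(2) cont] by blast
  have "1 \<le> max (H x) (H' x) * w x" if "x \<in> A \<union> B" for x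
  proof -
    have pos: "0 < w x" using w(2) that by blast
    have "1 / w x \<le> max (H x) (H' x)" using that H(2) H'(2) by (auto simp: le_max_iff_disj)
    then have "1 / w x * w x \<le> max (H x) (H' x) * w x" using pos by (intro mult_right_mono) auto
    then show ?thesis using pos by simp
  qed
  then show "\<exists>H. continuous_on UNIV H \<and> (\<forall>x\<in>A \<union> B. 1 \<le> H x * w x)"
    using H(1) H'(1) by (intro exI[of _ "\<lambda>x. max (H x) (H' x)"]) (auto intro!: continuous_intros)
qed

lemma C_embedded_homeo_image:
  fixes A :: "'a::topological_space set"
  assumes A: "C_embedded_in euclidean A" and T: "continuous_on UNIV T" "continuous_on UNIV T'" "\<And>x. T' (T x) = x"
  shows "C_embedded_in euclidean (T ` A :: 'a set)"
proof -
  have "\<exists>g. continuous_on UNIV g \<and> (\<forall>z\<in>T ` A. g z = f z)" if f: "continuous_on (T ` A) f" for f :: "'a \<Rightarrow> real"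
  proof -
    have "continuous_on A (\<lambda>x. f (T x))"
      by (intro continuous_on_compose2[OF f continuous_on_subset[OF T(1)]]) auto
    then obtain g where g: "continuous_on UNIV g" "\<And>z. z \<in> A \<Longrightarrow> g z = f (T z)"
      using C_embedded_in_euclideanD[OF A] by blast
    have "continuous_on UNIV (\<lambda>x. g (T' x))" by (intro continuous_on_compose2[OF g(1) T(2)]) auto
    then show ?thesis using g(2) T(3) by (intro exI[of _ "\<lambda>x. g (T' x)"]) auto
  qed
  then show ?thesis unfolding C_embedded_in_def by simp
qed

theorem corollary5p5:
  fixes I :: "'i set" and A B :: "('i \<Rightarrow> real) set" and f :: "('i \<Rightarrow> real) \<Rightarrow> ('i \<Rightarrow> real)"
  assumes "uncountable I"
    and "closedin (powertop_real I) A"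
    and "C_embedded_in (powertop_real I) A"
    and "Lindelof_space (subtopology (powertop_real I) A)"
    and "closedin (powertop_real I) B"
    and "C_embedded_in (powertop_real I) B"
    and "Lindelof_space (subtopology (powertop_real I) B)"
    and "homeomorphic_map (subtopology (powertop_real I) A) (subtopology (powertop_real I) B) f"
  shows "\<exists>h. homeomorphic_map (powertop_real I) (powertop_real I) h \<and> (\<forall>x\<in>A. h x = f x)"
proof -
  have ext: "A \<subseteq> extensional I" "B \<subseteq> extensional I"
    using assms(3,6) unfolding C_embedded_in_def powertop_real_eq by simp_all
  have top: "subtopology (powertop_real I) A = top_of_set A" "subtopology (powertop_real I) B = top_of_set B"
    unfolding powertop_real_eq subtopology_subtopology using ext by (simp_all add: Int_absorb1)
  have emb: "C_embedded_in euclidean A" "C_embedded_in euclidean B"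
    by (rule C_embedded_in_euclidean[OF assms(3)], rule C_embedded_in_euclidean[OF assms(6)])
  have "Lindelof_space (top_of_set (\<Union>{A, B}))"
    using assms(4,7) unfolding top by (intro Lindelof_space_Union) auto
  then have lin: "Lindelof_space (top_of_set (A \<union> B))" by simp
  obtain g where "homeomorphic_maps (top_of_set A) (top_of_set B) f g"
    using assms(8) unfolding top homeomorphic_map_maps by blast
  then have f: "continuous_on A f" "\<And>x. x \<in> A \<Longrightarrow> f x \<in> B" and g: "continuous_on B g" "\<And>x. x \<in> B \<Longrightarrow> g x \<in> A"
      "\<And>x. x \<in> A \<Longrightarrow> g (f x) = x"
    by (auto simp: homeomorphic_maps_def)
  obtain F G D K \<sigma> where flat: "supported_homeo D UNIV F G" "D \<subseteq> I" "K \<subseteq> I" "bij_betw \<sigma> K (I - K)"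
    "\<And>x k. x \<in> A \<union> B \<Longrightarrow> k \<in> K \<Longrightarrow> F x k = 0"
    by (rule flattening_homeo[OF lin C_embedded_union_separated[OF emb] assms(1)], rule that, assumption+)
  have FG: "supported_homeo I UNIV F G" using flat(1,2) by (rule supported_homeo_mono)
  note S = supported_homeoD[OF FG]
  obtain h h' where h: "supported_homeo I UNIV h h'" "\<And>x. x \<in> F ` A \<Longrightarrow> h x = F (f (G x))"
  proof (rule extend_between_flat_sets[OF flat(3,4), of "F ` A" "F ` B" "\<lambda>x. F (f (G x))" "\<lambda>y. F (g (G y))"])
    show "x k = 0" if "x \<in> F ` A \<union> F ` B" "k \<in> K" for x k using that flat(5) by blast
    show "C_embedded_in euclidean (F ` A)" "C_embedded_in euclidean (F ` B)"
      by (rule C_embedded_homeo_image[OF emb(1) S(1,2,3)], rule C_embedded_homeo_image[OF emb(2) S(1,2,3)])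
    have GA: "G ` F ` A \<subseteq> A" "G ` F ` B \<subseteq> B" by (auto simp: S(3))
    show "continuous_on (F ` A) (\<lambda>x. F (f (G x)))"
      by (intro continuous_on_compose2[OF S(1)] continuous_on_compose2[OF f(1)] continuous_on_subset[OF S(2)] GA) auto
    show "continuous_on (F ` B) (\<lambda>x. F (g (G x)))"
      by (intro continuous_on_compose2[OF S(1)] continuous_on_compose2[OF g(1)] continuous_on_subset[OF S(2)] GA) auto
    show "F (f (G x)) \<in> F ` B" if "x \<in> F ` A" for x using that f(2) by (auto simp: S(3))
    show "F (g (G (F (f (G x))))) = x" if "x \<in> F ` A" for x using that g(3) by (auto simp: S(3))
    show "F (f (G x)) i = x i" if x: "x \<in> F ` A" and i: "i \<notin> I" for x i
    proof -
      obtain a where a: "a \<in> A" "x = F a" using x by blast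
      have "F (f a) i = f a i" "F a i = a i" using S(6)[OF i] by blast+
      moreover have "f a i = a i" using ext a(1) f(2)[OF a(1)] i by (auto simp: extensional_def subset_iff)
      ultimately show ?thesis using a by (simp add: S(3))
    qed
  qed (rule that, assumption+)
  define H where "H x = G (h (F x))" for x
  define H' where "H' x = G (h' (F x))" for x
  have H: "supported_homeo I UNIV H H'"
    unfolding H_def[abs_def] H'_def[abs_def]
    using supported_homeo_compose[OF supported_homeo_compose[OF FG h(1)] supported_homeo_inverse[OF FG]] by simp
  note SH = supported_homeoD[OF H]
  have "H x \<in> extensional I" "H' x \<in> extensional I" if "x \<in> extensional I" for x
    using that SH(6,7) by (auto simp: extensional_def)
  then have "homeomorphic_maps (powertop_real I) (powertop_real I) H H'"
    unfolding powertop_real_eq homeomorphic_maps_def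
    using SH(3,4) by (auto intro: continuous_on_subset[OF SH(1)] continuous_on_subset[OF SH(2)])
  moreover have "H x = f x" if "x \<in> A" for x
    using h(2)[of "F x"] that by (simp add: H_def S(3))
  ultimately show ?thesis unfolding homeomorphic_map_maps by blast
qed

end
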